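(* Let $d\ge1$ be an integer, $\gamma^{**}=3\cdot 2^{1/d}$, $\varepsilon\in(0,1)$ and $\lambda\in[1,\infty]$. Let $(r_n)$ be a sequence such that, for all sufficiently large $n$, $$\gamma^{**}\left(\frac{\log n}{n}\right)^{1/d}<r_n<1,$$ and such that $$\lim_{n\to\infty}\frac{\log (n r_n^d)}{\log\log n}=\lambda .$$ Put $$c_n=\left\lfloor\sqrt{(1-\varepsilon)\left(\frac{\lambda}{\lambda-1/2}\right)\frac{\log n}{\log (n r_n^d)}}\right\rfloor ,$$ where $\lambda/(\lambda-1/2)$ is interpreted as $1$ if $\lambda=\infty$, and assume $2\le c_n<n$ for all sufficiently large $n$. Then $$\lim_{n\to\infty}\mathbf P\{S_n(r_n,c_n)\text{ is not connected}\}=1.$$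
   Context: Let $X_1,\dots,X_n$ be independent uniformly distributed random points in $[0,1]^d$. The random geometric graph $G_n(r)$ has vertex set $\{1,\dots,n\}$, and distinct $i,j$ are joined by an edge iff $\|X_i-X_j\|<r$ (Euclidean norm). For an integer $2\le c<n$, the Bluetooth (random irrigation) graph $S_n(r,c)$ is the following random undirected spanning subgraph of $G_n(r)$. Given $G_n(r)$, every vertex $v$ independently picks, uniformly at random without replacement, $c$ of the edges of $G_n(r)$ incident to $v$ (all of them if the degree of $v$ in $G_n(r)$ is less than $c$). The edge set of $S_n(r,c)$ is the union of all picked edges. *)

theory Defs
  imports "HOL-Probability.Probability"
begin

definition unit_cube :: "(real ^ 'd) set" where
  "unit_cube = {x. \<forall>i. 0 \<le> x $ i \<and> x $ i \<le> 1}"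

definition uniform_points :: "nat \<Rightarrow> (nat \<Rightarrow> real ^ 'd) measure" where
  "uniform_points n = Pi\<^sub>M {1..n} (\<lambda>_. uniform_measure lborel unit_cube)"

text \<open>Graphs on \<open>{1..n}\<close> are given by their edge sets; an edge is a two-element set of vertices.\<close>

definition geometric_edges :: "nat \<Rightarrow> real \<Rightarrow> (nat \<Rightarrow> real ^ 'd) \<Rightarrow> nat set set" where
  "geometric_edges n r x =
     {{i, j} |i j. i \<in> {1..n} \<and> j \<in> {1..n} \<and> i \<noteq> j \<and> norm (x i - x j) < r}"

definition incident_edges :: "nat set set \<Rightarrow> nat \<Rightarrow> nat set set" where
  "incident_edges E v = {e \<in> E. v \<in> e}"

text \<open>Drawing \<open>c\<close> of the incident edges without replacement yields a uniformly distributed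
  \<open>c\<close>-element subset; if fewer than \<open>c\<close> are available, the only candidate is the set of all of them.\<close>

definition pick_pmf :: "nat \<Rightarrow> nat set set \<Rightarrow> nat \<Rightarrow> nat set set pmf" where
  "pick_pmf c E v =
     pmf_of_set {F. F \<subseteq> incident_edges E v \<and> card F = min c (card (incident_edges E v))}"

definition irrigation_pmf :: "nat \<Rightarrow> nat \<Rightarrow> nat set set \<Rightarrow> nat set set pmf" where
  "irrigation_pmf n c E =
     map_pmf (\<lambda>F. \<Union>v\<in>{1..n}. F v) (Pi_pmf {1..n} {} (pick_pmf c E))"

text \<open>The law of the edge set of the irrigation graph: the points are drawn first, then the picks
  are made given the geometric graph. The type argument carries the dimension.\<close>

definition irrigation_graph :: "'d::finite itself \<Rightarrow> nat \<Rightarrow> real \<Rightarrow> nat \<Rightarrow> nat set set measure" where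
  "irrigation_graph _ n r c =
     (uniform_points n :: (nat \<Rightarrow> real ^ 'd) measure) \<bind>
       (\<lambda>x. measure_pmf (irrigation_pmf n c (geometric_edges n r x)))"

definition connected_graph :: "nat set \<Rightarrow> nat set set \<Rightarrow> bool" where
  "connected_graph V E \<longleftrightarrow> (\<forall>u\<in>V. \<forall>v\<in>V. (u, v) \<in> {(a, b). {a, b} \<in> E}\<^sup>*)"

text \<open>The kernel in \<^const>\<open>irrigation_graph\<close> is measurable, so the monadic bind is
  not degenerate.\<close>

lemma prob_space_uniform_cube:
  "prob_space (uniform_measure lborel (unit_cube :: (real ^ 'd) set))"
proof -
  have eq: "(unit_cube :: (real ^ 'd) set) = cbox 0 (\<chi> i. 1)"
    by (auto simp: unit_cube_def mem_box_cart)
  have "emeasure lborel (cbox (0 :: real ^ 'd) (\<chi> i. 1)) = ennreal 1"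
    by (subst emeasure_lborel_cbox) (auto simp: Basis_vec_def inner_axis intro!: prod.neutral)
  then show ?thesis
    unfolding eq by (intro prob_space_uniform_measure) auto
qed

lemma prob_space_uniform_points:
  "prob_space (uniform_points n :: (nat \<Rightarrow> real ^ 'd) measure)"
  unfolding uniform_points_def by (intro prob_space_PiM prob_space_uniform_cube)

lemma measurable_geometric_edges:
  "geometric_edges n r \<in> (uniform_points n :: (nat \<Rightarrow> real ^ 'd) measure)
     \<rightarrow>\<^sub>M count_space UNIV"
proof -
  let ?M = "uniform_points n :: (nat \<Rightarrow> real ^ 'd) measure"
  have sub: "geometric_edges n r x \<in> Pow (Pow {1..n})" for x :: "nat \<Rightarrow> real ^ 'd"
    by (auto simp: geometric_edges_def)
  have comp: "(\<lambda>x. x i) \<in> ?M \<rightarrow>\<^sub>M borel" if "i \<in> {1..n}" for i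
    using measurable_component_singleton[OF that, of "\<lambda>_. uniform_measure lborel (unit_cube :: (real ^ 'd) set)"]
    by (simp add: uniform_points_def cong: measurable_cong_sets)
  have edge: "Measurable.pred ?M (\<lambda>x. e \<in> geometric_edges n r x)" for e
  proof -
    have "(\<lambda>x :: nat \<Rightarrow> real ^ 'd. e \<in> geometric_edges n r x) =
        (\<lambda>x. \<exists>i\<in>{1..n}. \<exists>j\<in>{1..n}. (e = {i, j} \<and> i \<noteq> j) \<and> norm (x i - x j) < r)"
      by (fastforce simp: geometric_edges_def)
    moreover have "Measurable.pred ?M (\<lambda>x. norm (x i - x j) < r)"
      if "i \<in> {1..n}" "j \<in> {1..n}" for i j
      using comp[OF that(1)] comp[OF that(2)] by measurable
    ultimately show ?thesis
      by (auto intro!: pred_intros_finite pred_intros_logic)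
  qed
  have "geometric_edges n r \<in> ?M \<rightarrow>\<^sub>M count_space (Pow (Pow {1..n}))"
  proof (subst measurable_count_space_eq2, simp, intro conjI ballI)
    show "geometric_edges n r \<in> space ?M \<rightarrow> Pow (Pow {1..n})"
      using sub by blast
    fix A assume A: "A \<in> Pow (Pow {1..n})"
    have "geometric_edges n r -` {A} \<inter> space ?M =
        {x \<in> space ?M. \<forall>e\<in>Pow {1..n}. (e \<in> geometric_edges n r x) = (e \<in> A)}"
    proof -
      have ext: "X = Y \<longleftrightarrow> (\<forall>e\<in>P. (e \<in> X) = (e \<in> Y))"
        if "X \<subseteq> P" "Y \<subseteq> P" for X Y P :: "nat set set"
        using that by blast
      have "geometric_edges n r x = A \<longleftrightarrow>
          (\<forall>e\<in>Pow {1..n}. (e \<in> geometric_edges n r x) = (e \<in> A))" for x :: "nat \<Rightarrow> real ^ 'd"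
        by (rule ext[OF PowD[OF sub] PowD[OF A]])
      then show ?thesis
        by auto
    qed
    also have "\<dots> \<in> sets ?M"
      using edge unfolding pred_def[symmetric] by (auto intro!: pred_intros_finite pred_intros_logic)
    finally show "geometric_edges n r -` {A} \<inter> space ?M \<in> sets ?M" .
  qed
  then show ?thesis
    by (rule measurable_compose[where g = "\<lambda>E. E"]) simp
qed

lemma measurable_irrigation_kernel:
  "(\<lambda>x. measure_pmf (irrigation_pmf n c (geometric_edges n r x)))
     \<in> (uniform_points n :: (nat \<Rightarrow> real ^ 'd) measure) \<rightarrow>\<^sub>M prob_algebra (count_space UNIV)"
  by (rule measurable_compose[OF measurable_geometric_edges])
    (auto simp: space_prob_algebra prob_space_measure_pmf)

lemma prob_space_irrigation_graph: "prob_space (irrigation_graph TYPE('d::finite) n r c)"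
  and sets_irrigation_graph: "sets (irrigation_graph TYPE('d::finite) n r c) = UNIV"
proof -
  let ?M = "uniform_points n :: (nat \<Rightarrow> real ^ 'd) measure"
  have "?M \<in> space (prob_algebra ?M)"
    by (simp add: space_prob_algebra prob_space_uniform_points)
  from prob_space_bind'[OF this measurable_irrigation_kernel]
  show "prob_space (irrigation_graph TYPE('d) n r c)"
    by (simp add: irrigation_graph_def)
  from sets_bind'[OF \<open>?M \<in> space (prob_algebra ?M)\<close> measurable_irrigation_kernel]
  show "sets (irrigation_graph TYPE('d) n r c) = UNIV"
    by (simp add: irrigation_graph_def)
qed

end

theory Submission
  imports Defs
begin

text \<open>
  The irrigation graph is disconnected because it contains an isolated clique: \<open>c + 1\<close> vertices
  that lie close together, pick precisely each other, and are picked by nobody else. Let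
  \<open>N = n * r ^ d\<close>, which is the order of magnitude of all typical degrees. There are about
  \<open>n * (N / c) ^ c\<close> candidate cliques, up to a factor \<open>exp (O (c\<^sup>2))\<close>. Each of the \<open>c + 1\<close> members
  makes the required picks with probability about \<open>(c / N) ^ c\<close>, and the \<open>O (N)\<close> vertices around
  avoid the clique with probability \<open>exp (- O (c\<^sup>2))\<close>. Hence the expected number of isolated cliques
  is \<open>n * exp (- c\<^sup>2 * (ln N - ln c) - O (c\<^sup>2))\<close>. The choice of \<open>c\<close> makes
  \<open>c\<^sup>2 * (ln N - ln c)\<close> at most \<open>(1 - \<epsilon> / 2) * ln n\<close> (\<open>clique_exponent_bounds\<close>), and \<open>c\<^sup>2\<close> is of
  smaller order than \<open>ln n\<close> because \<open>N\<close> tends to infinity. So the expectation grows like a power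
  of \<open>n\<close>.

  That such a clique exists with high probability follows from a second moment argument, carried
  out conditionally on the points. Given the geometric graph, the picks of different vertices are
  independent, and isolation of a vertex set \<open>K\<close> means that no vertex picks an edge of its
  cut; the probability is therefore a product over the vertices. To control pairs, only
  cliques inside the central cells of pairwise remote blocks are counted. Cliques from different
  blocks are independent. Within a block, two cliques that overlap exclude each other, and two
  disjoint ones are isolated simultaneously with probability at most \<open>exp (O (c\<^sup>2))\<close> times the
  product of their probabilities. There are about \<open>n / N\<close> blocks, and \<open>c \<ge> 2\<close> implies
  \<open>N \<le> sqrt n\<close>; so this correlation is beaten by the number of blocks (\<open>prob_connected_le\<close>).

  The points enter only through the numbers of points in the cells of a block. These are close to
  their means with probability \<open>1 - O (1 / N)\<close> by Chebyshev's inequality, so with high probability at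
  least half of all blocks are good (\<open>prob_few_good_blocks\<close>). Requiring this of half of the blocks
  only avoids any uniform control of the degrees, which would fail in high dimension, where
  the lower bound on \<open>r\<close> does not even exclude isolated points of the geometric graph.
\<close>

section \<open>Second moments and binomial coefficients\<close>

text \<open>Chebyshev's inequality in terms of pair probabilities. It is needed twice: with independent
  events of equal probability, to count the points in a cell, and with the isolated cliques of one
  graph, where the deviation is taken as large as the mean.\<close>

lemma (in prob_space) prob_count_deviation_le:
  fixes A :: "'i \<Rightarrow> 'a set"
  assumes I: "finite I" and A: "\<And>i. i \<in> I \<Longrightarrow> A i \<in> events" and t: "0 < t"
  shows "prob {x \<in> space M. t \<le> \<bar>real (card {i \<in> I. x \<in> A i}) - (\<Sum>i\<in>I. prob (A i))\<bar>}
           \<le> ((\<Sum>i\<in>I. \<Sum>j\<in>I. prob (A i \<inter> A j)) - (\<Sum>i\<in>I. prob (A i))\<^sup>2) / t\<^sup>2"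
proof -
  let ?Z = "\<lambda>x. \<Sum>i\<in>I. indicat_real (A i) x"
  have card: "real (card {i \<in> I. x \<in> A i}) = ?Z x" for x
    using I by (simp add: indicator_def sum.If_cases Int_def)
  have sq: "(?Z x)\<^sup>2 = (\<Sum>i\<in>I. \<Sum>j\<in>I. indicat_real (A i \<inter> A j) x)" for x
    by (simp add: power2_eq_square sum_product indicator_inter_arith)
  have int1: "integrable M (indicat_real (A i))" if "i \<in> I" for i
    using A[OF that] by (simp add: emeasure_eq_measure)
  have int2: "integrable M (indicat_real (A i \<inter> A j))" if "i \<in> I" "j \<in> I" for i j
    using A[OF that(1)] A[OF that(2)] by (simp add: emeasure_eq_measure)
  have mean: "expectation ?Z = (\<Sum>i\<in>I. prob (A i))"
    using A int1 by (subst Bochner_Integration.integral_sum) (auto intro!: sum.cong)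
  have intZ: "integrable M ?Z" "integrable M (\<lambda>x. (?Z x)\<^sup>2)"
    unfolding sq using int1 int2 by (auto intro!: Bochner_Integration.integrable_sum)
  have sqmean: "expectation (\<lambda>x. (?Z x)\<^sup>2) = (\<Sum>i\<in>I. \<Sum>j\<in>I. prob (A i \<inter> A j))"
    unfolding sq using A int2
    by (subst Bochner_Integration.integral_sum)
      (auto intro!: sum.cong Bochner_Integration.integrable_sum simp: Bochner_Integration.integral_sum)
  have "prob {x \<in> space M. t \<le> \<bar>?Z x - expectation ?Z\<bar>} \<le> variance ?Z / t\<^sup>2"
    using intZ t by (intro Chebyshev_inequality) auto
  also have "variance ?Z = expectation (\<lambda>x. (?Z x)\<^sup>2) - (expectation ?Z)\<^sup>2"
    by (rule variance_eq[OF intZ])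
  finally show ?thesis
    by (simp only: card mean sqmean)
qed

lemma measure_pick_avoid:
  assumes fin: "finite (incident_edges E v)" and c: "c \<le> card (incident_edges E v)"
  shows "measure_pmf.prob (pick_pmf c E v) {F. F \<inter> C = {}} =
           (card (incident_edges E v - C) choose c) / (card (incident_edges E v) choose c)"
proof -
  let ?D = "incident_edges E v"
  let ?S = "{F. F \<subseteq> ?D \<and> card F = c}"
  have fS: "finite ?S" using fin by auto
  have cS: "card ?S = card ?D choose c" using n_subsets[OF fin] by simp
  have "card ?S > 0" unfolding cS using c by simp
  then have ne: "?S \<noteq> {}" by force
  have "{F. F \<inter> C = {}} \<inter> ?S = {F. F \<subseteq> ?D - C \<and> card F = c}" by auto
  then have "card (?S \<inter> {F. F \<inter> C = {}}) = card (?D - C) choose c"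
    using n_subsets[of "?D - C" c] fin by (simp add: Int_commute)
  then show ?thesis
    using c ne fS cS by (simp add: pick_pmf_def measure_pmf_of_set min_absorb1)
qed

lemma set_pick_pmf:
  assumes "finite (incident_edges E v)"
  shows "set_pmf (pick_pmf c E v) =
    {F. F \<subseteq> incident_edges E v \<and> card F = min c (card (incident_edges E v))}"
proof -
  let ?S = "{F. F \<subseteq> incident_edges E v \<and> card F = min c (card (incident_edges E v))}"
  obtain F where "F \<subseteq> incident_edges E v" "card F = min c (card (incident_edges E v))"
    using obtain_subset_with_card_n[of "min c (card (incident_edges E v))" "incident_edges E v"] by auto
  then have "?S \<noteq> {}" by auto
  moreover have "finite ?S" using assms by auto
  ultimately show ?thesis by (simp add: pick_pmf_def)
qed

lemma one_minus_ge_exp: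
  fixes y :: real
  assumes "0 \<le> y" "y \<le> 1 / 2"
  shows "exp (- 2 * y) \<le> 1 - y"
proof -
  have "1 \<le> (1 - y) * (1 + 2 * y)"
  proof -
    have "0 \<le> y * (1 - 2 * y)" using assms by simp
    then show ?thesis by (simp add: algebra_simps)
  qed
  also have "\<dots> \<le> (1 - y) * exp (2 * y)"
    using assms exp_ge_add_one_self[of "2 * y"] by (intro mult_left_mono) auto
  finally show ?thesis
    by (simp add: exp_minus field_simps)
qed

text \<open>The probability that a draw of \<open>c\<close> out of \<open>D\<close> objects misses \<open>k\<close> given ones is
  bounded below by removing the \<open>k\<close> objects one at a time: each removal from a set of at least
  \<open>D / 2\<close> objects costs a factor of at least \<open>1 - 2 c / D\<close>.\<close>

lemma choose_diff_ge:
  fixes D k c :: nat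
  assumes "2 * k \<le> D" "4 * c \<le> D" "0 < D"
  shows "exp (- (4 * c * k / D)) * real (D choose c) \<le> real ((D - k) choose c)"
  using assms
proof (induction k)
  case 0
  then show ?case by simp
next
  case (Suc k)
  let ?m = "D - k"
  have m: "D \<le> 2 * ?m" "1 \<le> ?m" "c \<le> ?m" using Suc.prems by auto
  have absorb: "real (?m - c) * real (?m choose c) = real ?m * real ((D - Suc k) choose c)"
    using binomial_absorb_comp[of ?m c] by (metis diff_Suc_eq_diff_pred diff_commute of_nat_mult)
  have y: "real c / real ?m \<le> 2 * c / D" using m Suc.prems
  proof -
    have "real c * real D \<le> real c * (2 * real ?m)"
      using m(1) by (intro mult_left_mono) linarith+
    then show ?thesis using m Suc.prems by (simp add: field_simps)
  qed
  have y2: "2 * real c / D \<le> 1 / 2" using Suc.prems by (simp add: field_simps)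
  have "exp (- (4 * c / D)) \<le> 1 - 2 * real c / D"
    using one_minus_ge_exp[of "2 * real c / D"] y2 by simp
  also have "\<dots> \<le> 1 - real c / ?m" using y by simp
  finally have e: "exp (- (4 * c / D)) \<le> 1 - real c / ?m" .
  have "exp (- (4 * c * Suc k / D)) * real (D choose c)
      = exp (- (4 * c / D)) * (exp (- (4 * c * k / D)) * real (D choose c))"
    using Suc.prems by (simp add: exp_add[symmetric] field_simps)
  also have "\<dots> \<le> (1 - real c / ?m) * real (?m choose c)"
    using e Suc by (intro mult_mono) (auto intro: order_trans[OF exp_ge_zero])
  also have "\<dots> = real ((D - Suc k) choose c)"
    using absorb m by (simp add: field_simps of_nat_diff)
  finally show ?case .
qed

section \<open>Isolated cliques in a fixed graph\<close>

text \<open>The edges with exactly one endpoint in \<open>K\<close>, written so that it makes sense for any set of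
  vertices \<open>e\<close>. A vertex set is isolated in a graph iff the graph contains no edge of its cut.\<close>

definition cut :: "nat set \<Rightarrow> nat set set" where
  "cut K = {e. e \<inter> K \<noteq> {} \<and> \<not> e \<subseteq> K}"

text \<open>A lower bound for the probability that a given clique on \<open>c + 1\<close> vertices gets isolated, if
  the degrees around it lie between \<open>D1\<close> and \<open>D2\<close>. The power bounds the probability that
  its members pick each other; the exponential accounts for the at most \<open>D2\<close> vertices around it, which
  have to pick none of the \<open>c + 1\<close> members.\<close>

definition isolation_bound :: "nat \<Rightarrow> nat \<Rightarrow> nat \<Rightarrow> real" where
  "isolation_bound c D1 D2 =
     (1 / (D2 choose c)) ^ (c + 1) * exp (- (4 * c * (c + 1) * D2 / D1))"

text \<open>The part of a geometric graph that matters: a site \<open>i\<close> carries a clique \<open>Q i\<close> of \<open>L\<close>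
  vertices, and \<open>W i\<close> contains all neighbours of that clique. The sets \<open>W i\<close> are disjoint, so
  distinct sites do not influence each other.\<close>

locale crowded_sites =
  fixes n c L D1 D2 :: nat and E :: "nat set set" and I :: "'i set"
    and Q W :: "'i \<Rightarrow> nat set"
  assumes finite_I: "finite I" and I_nonempty: "I \<noteq> {}"
    and edges: "e \<in> E \<Longrightarrow> \<exists>u\<in>{1..n}. \<exists>v\<in>{1..n}. u \<noteq> v \<and> e = {u, v}"
    and Q_sub_W: "i \<in> I \<Longrightarrow> Q i \<subseteq> W i" and W_sub: "i \<in> I \<Longrightarrow> W i \<subseteq> {1..n}"
    and clique: "i \<in> I \<Longrightarrow> u \<in> Q i \<Longrightarrow> v \<in> Q i \<Longrightarrow> u \<noteq> v \<Longrightarrow> {u, v} \<in> E"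
    and neighbour: "i \<in> I \<Longrightarrow> {u, v} \<in> E \<Longrightarrow> u \<in> Q i \<Longrightarrow> v \<in> W i"
    and W_disjoint: "i \<in> I \<Longrightarrow> j \<in> I \<Longrightarrow> i \<noteq> j \<Longrightarrow> W i \<inter> W j = {}"
    and card_Q: "i \<in> I \<Longrightarrow> card (Q i) = L" and card_W: "i \<in> I \<Longrightarrow> card (W i) \<le> D2"
    and degree: "i \<in> I \<Longrightarrow> v \<in> W i \<Longrightarrow>
      D1 \<le> card (incident_edges E v) \<and> card (incident_edges E v) \<le> D2"
    and c_L: "c + 1 \<le> L" and c_D1: "4 * (c + 1) \<le> D1" and c_n: "c + 1 < n"
begin

abbreviation picks :: "(nat \<Rightarrow> nat set set) pmf" where
  "picks \<equiv> Pi_pmf {1..n} {} (pick_pmf c E)"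

abbreviation p_min :: real where
  "p_min \<equiv> isolation_bound c D1 D2"

definition avoid :: "nat set set \<Rightarrow> nat \<Rightarrow> real" where
  "avoid C v = measure_pmf.prob (pick_pmf c E v) {F. F \<inter> C = {}}"

definition avoid_all :: "nat set set \<Rightarrow> (nat \<Rightarrow> nat set set) set" where
  "avoid_all C = {F. \<forall>v\<in>{1..n}. F v \<inter> C = {}}"

definition cliques :: "'i \<Rightarrow> nat set set" where
  "cliques i = {K. K \<subseteq> Q i \<and> card K = c + 1}"

lemma finite_E: "finite E"
proof (rule finite_subset)
  show "E \<subseteq> Pow {1..n}" using edges by blast
qed simp

lemma finite_incident [simp]: "finite (incident_edges E v)"
  unfolding incident_edges_def using finite_E by simp

lemma incident_edgeE:
  assumes "e \<in> incident_edges E v"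
  obtains w where "e = {v, w}" "w \<noteq> v" "{v, w} \<in> E"
proof -
  from assms have e: "e \<in> E" "v \<in> e" by (auto simp: incident_edges_def)
  from edges[OF e(1)] obtain a b where "a \<noteq> b" "e = {a, b}" by blast
  with e that[of a] that[of b] show ?thesis by (auto simp: insert_commute)
qed

lemma finite_W: "i \<in> I \<Longrightarrow> finite (W i)"
  using W_sub finite_subset by blast

lemma finite_Q: "i \<in> I \<Longrightarrow> finite (Q i)"
  using finite_W Q_sub_W finite_subset by blast

lemma finite_clique: "K \<in> cliques i \<Longrightarrow> finite K"
  unfolding cliques_def using card.infinite by fastforce

lemma clique_sub_W: "i \<in> I \<Longrightarrow> K \<in> cliques i \<Longrightarrow> K \<subseteq> W i"
  unfolding cliques_def using Q_sub_W by blast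

lemma clique_sub: "i \<in> I \<Longrightarrow> K \<in> cliques i \<Longrightarrow> K \<subseteq> {1..n}"
  using clique_sub_W W_sub by blast

lemma avoid_nonneg [simp]: "0 \<le> avoid C v" and avoid_le_1 [simp]: "avoid C v \<le> 1"
  unfolding avoid_def by auto

text \<open>Isolation of a vertex set is a condition on the pick of each vertex separately, so its
  probability is a product over the vertices. This is what makes all pair probabilities computable.\<close>

lemma prob_avoid_all: "measure_pmf.prob picks (avoid_all C) = (\<Prod>v\<in>{1..n}. avoid C v)"
proof -
  have "avoid_all C = Pi {1..n} (\<lambda>_. {F. F \<inter> C = {}})"
    by (auto simp: avoid_all_def)
  then show ?thesis by (simp only: measure_Pi_pmf_Pi finite_atLeastAtMost avoid_def)
qed

lemma avoid_all_Un: "avoid_all C \<inter> avoid_all C' = avoid_all (C \<union> C')"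
  by (auto simp: avoid_all_def)

lemma cut_incident_imp_W:
  assumes "i \<in> I" "K \<in> cliques i" "e \<in> incident_edges E v" "e \<in> cut K"
  shows "v \<in> W i"
proof -
  obtain w where w: "e = {v, w}" "{v, w} \<in> E"
    using assms(3) by (rule incident_edgeE)
  have "K \<subseteq> Q i" using assms(2) by (simp add: cliques_def)
  moreover from assms(4) w(1) have "v \<in> K \<or> w \<in> K" by (auto simp: cut_def)
  ultimately show ?thesis
    using neighbour[OF assms(1), of w v] w Q_sub_W[OF assms(1)]
    by (auto simp: insert_commute)
qed

lemma avoid_Un_eq:
  assumes "incident_edges E v \<inter> C = {}"
  shows "avoid (C \<union> C') v = avoid C' v"
proof -
  have "F \<inter> (C \<union> C') = {} \<longleftrightarrow> F \<inter> C' = {}" if "F \<in> set_pmf (pick_pmf c E v)" for F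
    using that assms by (auto simp: set_pick_pmf)
  then show ?thesis
    unfolding avoid_def by (intro measure_pmf.finite_measure_eq_AE) (auto simp: AE_measure_pmf_iff)
qed

lemma avoid_eq_1:
  assumes "incident_edges E v \<inter> C = {}"
  shows "avoid C v = 1"
  using avoid_Un_eq[OF assms, of "{}"] by (simp add: avoid_def)

text \<open>No vertex has incident edges in the cuts of two cliques from different sites, so for each
  vertex one of the two conditions is void.\<close>

lemma prob_isolated_two_sites:
  assumes "i \<in> I" "j \<in> I" "i \<noteq> j" "K \<in> cliques i" "K' \<in> cliques j"
  shows "measure_pmf.prob picks (avoid_all (cut K) \<inter> avoid_all (cut K'))
    = measure_pmf.prob picks (avoid_all (cut K)) * measure_pmf.prob picks (avoid_all (cut K'))"
proof -
  have "avoid (cut K \<union> cut K') v = avoid (cut K) v * avoid (cut K') v" for v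
  proof (cases "v \<in> W i")
    case True
    then have "v \<notin> W j" using W_disjoint[OF assms(1-3)] by blast
    then have *: "incident_edges E v \<inter> cut K' = {}"
      using cut_incident_imp_W[OF assms(2,5)] by blast
    show ?thesis
      using avoid_Un_eq[OF *, of "cut K"] avoid_eq_1[OF *] by (simp add: Un_commute)
  next
    case False
    then have *: "incident_edges E v \<inter> cut K = {}"
      using cut_incident_imp_W[OF assms(1,4)] by blast
    show ?thesis
      using avoid_Un_eq[OF *, of "cut K'"] avoid_eq_1[OF *] by simp
  qed
  then show ?thesis
    unfolding avoid_all_Un prob_avoid_all by (simp add: prod.distrib)
qed

lemma inner_edges:
  assumes "v \<in> K"
  shows "incident_edges E v - cut K \<subseteq> (\<lambda>w. {v, w}) ` (K - {v})"
proof
  fix e assume e: "e \<in> incident_edges E v - cut K"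
  then obtain w where w: "e = {v, w}" "w \<noteq> v" by (auto elim: incident_edgeE)
  have "e \<subseteq> K" using e assms w by (auto simp: cut_def)
  then show "e \<in> (\<lambda>w. {v, w}) ` (K - {v})" using w by auto
qed

lemma inj_star: "inj_on (\<lambda>w. {v, w}) A" for v :: nat
  by (auto simp: inj_on_def doubleton_eq_iff)

text \<open>A member of a clique on \<open>c + 1\<close> vertices has at most \<open>c\<close> edges inside it, hence at most
  one admissible pick.\<close>

lemma avoid_member_le:
  assumes i: "i \<in> I" and K: "K \<in> cliques i" and v: "v \<in> K" and C: "cut K \<subseteq> C"
  shows "avoid C v \<le> 1 / (D1 choose c)"
proof -
  let ?d = "card (incident_edges E v)"
  have d: "D1 \<le> ?d" using degree[OF i] clique_sub_W[OF i K] v by blast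
  have "card (incident_edges E v - C) \<le> card ((\<lambda>w. {v, w}) ` (K - {v}))"
    using inner_edges[OF v] C finite_clique[OF K] by (intro card_mono) auto
  also have "\<dots> \<le> card (K - {v})" using finite_clique[OF K] by (intro card_image_le) auto
  also have "\<dots> = c" using K v by (simp add: cliques_def)
  finally have "card (incident_edges E v - C) choose c \<le> 1"
    using binomial_right_mono[of "card (incident_edges E v - C)" c c] by simp
  then have "avoid C v \<le> 1 / (?d choose c)"
    unfolding avoid_def using d c_D1 by (subst measure_pick_avoid) (auto intro!: divide_right_mono)
  also have "\<dots> \<le> 1 / (D1 choose c)"
    using binomial_right_mono[OF d, of c] c_D1 d by (intro divide_left_mono mult_pos_pos) auto
  finally show ?thesis .
qed

text \<open>Disjoint cliques force the picks of all their \<open>2 (c + 1)\<close> members. Two different cliques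
  with a common vertex \<open>v\<close> cannot both be isolated: \<open>v\<close> would have to make its \<open>c\<close> picks inside
  the intersection, which offers fewer than \<open>c\<close> edges.\<close>

lemma prob_isolated_same_site_le:
  assumes i: "i \<in> I" and K: "K \<in> cliques i" "K' \<in> cliques i" "K \<noteq> K'"
  shows "measure_pmf.prob picks (avoid_all (cut K) \<inter> avoid_all (cut K'))
    \<le> ((1 / (D1 choose c)) ^ (c + 1))\<^sup>2"
proof (cases "K \<inter> K' = {}")
  case True
  have fin: "finite K" "finite K'" using K finite_clique by auto
  have "(\<Prod>v\<in>{1..n}. avoid (cut K \<union> cut K') v) \<le>
      (\<Prod>v\<in>{1..n}. if v \<in> K \<union> K' then 1 / (D1 choose c) else 1)"
    using avoid_member_le[OF i K(1)] avoid_member_le[OF i K(2)] by (intro prod_mono) auto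
  also have "\<dots> = (\<Prod>v\<in>K \<union> K'. 1 / (D1 choose c))"
    using clique_sub[OF i K(1)] clique_sub[OF i K(2)]
    by (subst prod.If_cases) (auto simp: Int_absorb1 intro!: arg_cong[where f = "\<lambda>A. x ^ card A" for x])
  also have "\<dots> = (1 / (D1 choose c)) ^ (c + 1 + (c + 1))"
    using card_Un_disjoint[OF fin True] K by (simp add: cliques_def)
  finally show ?thesis
    unfolding avoid_all_Un prob_avoid_all by (simp add: power2_eq_square power_add)
next
  case False
  then obtain v where v: "v \<in> K" "v \<in> K'" by blast
  let ?C = "cut K \<union> cut K'"
  have cards: "card K = c + 1" "card K' = c + 1" using K by (auto simp: cliques_def)
  have "\<not> K \<subseteq> K'"
    using card_subset_eq[OF finite_clique[OF K(2)], of K] cards K(3) by auto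
  then have "K \<inter> K' \<subset> K" by blast
  then have "card (K \<inter> K') < c + 1"
    using psubset_card_mono[OF finite_clique[OF K(1)], of "K \<inter> K'"] cards by simp
  moreover have "incident_edges E v - ?C \<subseteq> (\<lambda>w. {v, w}) ` (K \<inter> K' - {v})"
  proof
    fix e assume e: "e \<in> incident_edges E v - ?C"
    then obtain w w' where "e = {v, w}" "w \<in> K - {v}" "e = {v, w'}" "w' \<in> K' - {v}"
      using inner_edges[OF v(1)] inner_edges[OF v(2)] by blast
    then show "e \<in> (\<lambda>w. {v, w}) ` (K \<inter> K' - {v})" by (auto simp: doubleton_eq_iff)
  qed
  then have "card (incident_edges E v - ?C) \<le> card (K \<inter> K' - {v})"
    using finite_clique[OF K(1)] by (intro surj_card_le) auto
  moreover have "card (K \<inter> K' - {v}) = card (K \<inter> K') - 1" "card (K \<inter> K') > 0"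
    using v finite_clique[OF K(1)] by (auto simp: card_gt_0_iff)
  ultimately have "card (incident_edges E v - ?C) < c" by linarith
  moreover have "c \<le> card (incident_edges E v)"
    using degree[OF i, of v] clique_sub_W[OF i K(1)] v c_D1 by force
  ultimately have "avoid ?C v = 0"
    unfolding avoid_def by (subst measure_pick_avoid) auto
  moreover have "v \<in> {1..n}" using clique_sub[OF i K(1)] v by blast
  ultimately show ?thesis
    unfolding avoid_all_Un prob_avoid_all by (subst prod_zero) auto
qed

text \<open>Each member has at most \<open>D2 choose c\<close> possible picks, one of which stays inside the clique.
  The other vertices of \<open>W i\<close> have to avoid at most \<open>c + 1\<close> of their edges, which is
  \<open>choose_diff_ge\<close>; vertices outside \<open>W i\<close> see no edge of the cut.\<close>

lemma prob_isolated_ge: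
  assumes i: "i \<in> I" and K: "K \<in> cliques i"
  shows "p_min \<le> measure_pmf.prob picks (avoid_all (cut K))"
proof -
  let ?g = "exp (- (real (4 * c * (c + 1)) / D1))"
  have KW: "K \<subseteq> W i" by (rule clique_sub_W[OF i K])
  have member: "1 / (D2 choose c) \<le> avoid (cut K) v" if v: "v \<in> K" for v
  proof -
    have d: "D1 \<le> card (incident_edges E v)" "card (incident_edges E v) \<le> D2"
      using degree[OF i] KW v by auto
    have "(\<lambda>w. {v, w}) ` (K - {v}) \<subseteq> incident_edges E v - cut K"
      using clique[OF i] v K by (auto simp: incident_edges_def cut_def cliques_def subset_iff)
    then have "card (K - {v}) \<le> card (incident_edges E v - cut K)"
      using card_image[OF inj_star] card_mono[of "incident_edges E v - cut K"] by (metis finite_Diff finite_incident)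
    then have "c \<le> card (incident_edges E v - cut K)" using K v by (simp add: cliques_def)
    then have 1: "1 \<le> card (incident_edges E v - cut K) choose c"
      by (simp add: Suc_le_eq)
    have "1 / (D2 choose c) \<le> 1 / (card (incident_edges E v) choose c)"
      using d c_D1 binomial_right_mono[OF d(2), of c] by (intro divide_left_mono) auto
    also have "\<dots> \<le> avoid (cut K) v"
      unfolding avoid_def using 1 d c_D1 by (subst measure_pick_avoid) (auto intro!: divide_right_mono)
    finally show ?thesis .
  qed
  have other: "?g \<le> avoid (cut K) v" if v: "v \<in> W i" "v \<notin> K" for v
  proof -
    let ?d = "card (incident_edges E v)"
    have d: "D1 \<le> ?d" using degree[OF i] v by auto
    have "incident_edges E v \<inter> cut K \<subseteq> (\<lambda>w. {v, w}) ` K"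
    proof
      fix e assume e: "e \<in> incident_edges E v \<inter> cut K"
      then obtain w where "e = {v, w}" by (auto elim: incident_edgeE)
      then show "e \<in> (\<lambda>w. {v, w}) ` K" using e v by (auto simp: cut_def)
    qed
    then have "card (incident_edges E v \<inter> cut K) \<le> card K"
      by (intro surj_card_le finite_clique[OF K])
    then have "card (incident_edges E v \<inter> cut K) \<le> c + 1"
      using K by (simp add: cliques_def)
    then have k: "?d - (c + 1) \<le> card (incident_edges E v - cut K)"
      by (simp add: card_Diff_subset_Int)
    have "real (4 * c * (c + 1)) / ?d \<le> real (4 * c * (c + 1)) / D1"
      using d c_D1 by (intro divide_left_mono mult_pos_pos) auto
    then have "?g \<le> exp (- (real (4 * c * (c + 1)) / ?d))" by simp
    moreover have "exp (- (real (4 * c * (c + 1)) / ?d)) * real (?d choose c) \<le> real ((?d - (c + 1)) choose c)"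
      using d c_D1 by (intro choose_diff_ge) auto
    moreover have "real ((?d - (c + 1)) choose c) \<le> real (card (incident_edges E v - cut K) choose c)"
      using binomial_right_mono[OF k] by simp
    ultimately have "?g * real (?d choose c) \<le> real (card (incident_edges E v - cut K) choose c)"
      by (meson mult_right_mono of_nat_0_le_iff order_trans)
    then show ?thesis
      unfolding avoid_def using d c_D1 by (subst measure_pick_avoid) (auto simp: pos_le_divide_eq)
  qed
  have "p_min = (1 / (D2 choose c)) ^ (c + 1) * ?g ^ D2"
    unfolding isolation_bound_def by (simp add: exp_of_nat_mult[symmetric] field_simps)
  also have "\<dots> \<le> (1 / (D2 choose c)) ^ card K * ?g ^ card (W i - K)"
  proof -
    have "card K = c + 1" using K by (simp add: cliques_def)
    moreover have "card (W i - K) \<le> D2" using card_W[OF i] card_mono[OF finite_W[OF i], of "W i - K"] by auto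
    ultimately show ?thesis by (auto intro!: mult_left_mono power_decreasing simp del: power_Suc)
  qed
  also have "\<dots> = (\<Prod>v\<in>K. 1 / (D2 choose c)) * (\<Prod>v\<in>W i - K. ?g)" by simp
  also have "\<dots> \<le> (\<Prod>v\<in>K. avoid (cut K) v) * (\<Prod>v\<in>W i - K. avoid (cut K) v)"
    using member other by (intro mult_mono prod_mono prod_nonneg) auto
  also have "\<dots> = (\<Prod>v\<in>W i. avoid (cut K) v)"
    using prod.subset_diff[OF KW finite_W[OF i], of "avoid (cut K)"] by (simp add: mult.commute)
  also have "\<dots> = (\<Prod>v\<in>{1..n}. avoid (cut K) v)"
  proof (intro prod.mono_neutral_left)
    show "\<forall>v\<in>{1..n} - W i. avoid (cut K) v = 1"
      using cut_incident_imp_W[OF i K] by (intro ballI avoid_eq_1) blast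
  qed (use W_sub[OF i] in auto)
  finally show ?thesis unfolding prob_avoid_all .
qed

lemma isolated_imp_disconnected:
  assumes K: "K \<noteq> {}" "K \<subseteq> {1..n}" "card K < n" and F: "F \<in> avoid_all (cut K)"
  shows "\<not> connected_graph {1..n} (\<Union>v\<in>{1..n}. F v)"
proof
  let ?R = "{(a, b). {a, b} \<in> (\<Union>v\<in>{1..n}. F v)}"
  assume conn: "connected_graph {1..n} (\<Union>v\<in>{1..n}. F v)"
  obtain u where u: "u \<in> K" using K by blast
  obtain w where w: "w \<in> {1..n}" "w \<notin> K"
  proof -
    have "\<not> {1..n} \<subseteq> K"
      using K card_mono[of K "{1..n}"] finite_subset[OF K(2)] by auto
    then show ?thesis using that by blast
  qed
  have "(u, w) \<in> ?R\<^sup>*" using conn u w K unfolding connected_graph_def by blast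
  then have "w \<in> K"
  proof (induction rule: rtrancl_induct)
    case base
    show ?case by (rule u)
  next
    case (step y z)
    then obtain v where "v \<in> {1..n}" "{y, z} \<in> F v" by blast
    then have "{y, z} \<notin> cut K" using F unfolding avoid_all_def by blast
    then show ?case using step.IH by (auto simp: cut_def)
  qed
  then show False using w by blast
qed

text \<open>If the graph is connected, then no clique is isolated, so the number of isolated cliques
  deviates from its mean \<open>\<mu>\<close> by \<open>\<mu>\<close>. In the second moment, pairs from different sites add up to at
  most \<open>\<mu>\<^sup>2\<close>, the diagonal gives \<open>\<mu>\<close>, and the pairs within one site give at most
  \<open>card I * T\<^sup>2 * q\<^sup>2\<close>. The last term is harmless as soon as the number of sites is large compared
  to \<open>(q / p_min)\<^sup>2\<close>.\<close>

theorem prob_connected_le: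
  fixes T q :: real
  defines "T \<equiv> real (L choose (c + 1))"
    and "q \<equiv> (1 / real (D1 choose c)) ^ (c + 1)"
  shows "measure_pmf.prob (irrigation_pmf n c E) {E'. connected_graph {1..n} E'}
    \<le> 1 / (card I * T * p_min) + (q / p_min)\<^sup>2 / card I"
proof -
  let ?J = "Sigma I cliques"
  let ?A = "\<lambda>(i, K). avoid_all (cut K)"
  let ?P = "\<lambda>x. measure_pmf.prob picks (?A x)"
  define \<mu> where "\<mu> = (\<Sum>x\<in>?J. ?P x)"
  define m where "m = real (card I)"
  have fin_cl: "finite (cliques i)" if "i \<in> I" for i
    unfolding cliques_def using finite_Q[OF that] by simp
  have card_cl: "real (card (cliques i)) = T" if "i \<in> I" for i
    unfolding cliques_def T_def using n_subsets[OF finite_Q[OF that]] card_Q[OF that] by simp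
  have finJ: "finite ?J" using finite_I fin_cl by auto
  have cardJ: "real (card ?J) = m * T"
    using finite_I fin_cl card_cl by (simp add: card_SigmaI m_def)
  have T: "T > 0" unfolding T_def using c_L by simp
  have m: "m > 0" unfolding m_def using finite_I I_nonempty by (simp add: card_gt_0_iff)
  obtain i0 where i0: "i0 \<in> I" using I_nonempty by blast
  have "D1 \<le> D2"
  proof -
    have "Q i0 \<noteq> {}" using card_Q[OF i0] c_L by auto
    then show ?thesis using degree[OF i0] Q_sub_W[OF i0] by (meson all_not_in_conv order_trans subsetD)
  qed
  then have p: "p_min > 0" unfolding isolation_bound_def using c_D1 by (auto intro!: mult_pos_pos)
  have "m * T * p_min = (\<Sum>x\<in>?J. p_min)" using cardJ by simp
  also have "\<dots> \<le> \<mu>" unfolding \<mu>_def using prob_isolated_ge by (intro sum_mono) auto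
  finally have \<mu>_ge: "m * T * p_min \<le> \<mu>" .
  have mTp: "0 < m * T * p_min" using m T p by simp
  then have \<mu>: "\<mu> > 0" using \<mu>_ge by linarith
  have pair: "measure_pmf.prob picks (?A x \<inter> ?A y)
      \<le> ?P x * ?P y + (if x = y then ?P x else 0) + (if fst x = fst y then q\<^sup>2 else 0)"
    if xy: "x \<in> ?J" "y \<in> ?J" for x y
  proof -
    obtain i K j K' where ij: "x = (i, K)" "y = (j, K')" by fastforce
    consider "i \<noteq> j" | "i = j" "K \<noteq> K'" | "i = j" "K = K'" by blast
    then show ?thesis
    proof cases
      case 1
      then show ?thesis using prob_isolated_two_sites[of i j K K'] xy ij by auto
    next
      case 2
      then show ?thesis using prob_isolated_same_site_le[of i K K'] xy ij
        by (auto simp: q_def intro!: add_increasing)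
    next
      case 3
      then show ?thesis using ij by simp
    qed
  qed
  have "(\<Sum>x\<in>?J. \<Sum>y\<in>?J. measure_pmf.prob picks (?A x \<inter> ?A y))
      \<le> (\<Sum>x\<in>?J. \<Sum>y\<in>?J. ?P x * ?P y + (if x = y then ?P x else 0) + (if fst x = fst y then q\<^sup>2 else 0))"
    by (intro sum_mono pair)
  also have "\<dots> = \<mu>\<^sup>2 + \<mu> + (\<Sum>x\<in>?J. \<Sum>y\<in>?J. if fst x = fst y then q\<^sup>2 else 0)"
    unfolding sum.distrib \<mu>_def power2_eq_square sum_product using finJ by simp
  also have "(\<Sum>x\<in>?J. \<Sum>y\<in>?J. if fst x = fst y then q\<^sup>2 else 0) = m * T\<^sup>2 * q\<^sup>2"
  proof -
    have "(\<Sum>y\<in>?J. if fst x = fst y then q\<^sup>2 else 0) = T * q\<^sup>2" if "x \<in> ?J" for x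
    proof -
      have "{y \<in> ?J. fst x = fst y} = Pair (fst x) ` cliques (fst x)" using that by auto
      then have "card {y \<in> ?J. fst x = fst y} = card (cliques (fst x))"
        by (simp add: card_image inj_on_def)
      moreover have "fst x \<in> I" using that by auto
      ultimately show ?thesis
        using finJ card_cl by (simp add: sum.If_cases Int_def mem_Times_iff split: prod.splits)
    qed
    then show ?thesis using cardJ by (simp add: power2_eq_square)
  qed
  finally have second: "(\<Sum>x\<in>?J. \<Sum>y\<in>?J. measure_pmf.prob picks (?A x \<inter> ?A y)) - \<mu>\<^sup>2
      \<le> \<mu> + m * T\<^sup>2 * q\<^sup>2" by simp
  have "measure_pmf.prob (irrigation_pmf n c E) {E'. connected_graph {1..n} E'}
      = measure_pmf.prob picks {F. connected_graph {1..n} (\<Union>v\<in>{1..n}. F v)}"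
    by (simp add: irrigation_pmf_def vimage_def)
  also have "\<dots> \<le> measure_pmf.prob picks
      {F \<in> space (measure_pmf picks). \<mu> \<le> \<bar>real (card {x \<in> ?J. F \<in> ?A x}) - \<mu>\<bar>}"
  proof (intro measure_pmf.finite_measure_mono subsetI CollectI conjI)
    fix F assume F: "F \<in> {F. connected_graph {1..n} (\<Union>v\<in>{1..n}. F v)}"
    have "{x \<in> ?J. F \<in> ?A x} = {}"
    proof (rule ccontr)
      assume "{x \<in> ?J. F \<in> ?A x} \<noteq> {}"
      then obtain i K where iK: "i \<in> I" "K \<in> cliques i" "F \<in> avoid_all (cut K)" by auto
      have "card K = c + 1" using iK by (simp add: cliques_def)
      then have "K \<noteq> {}" "card K < n" using c_n by auto
      then show False
        using isolated_imp_disconnected[OF _ clique_sub[OF iK(1,2)] _ iK(3)] F by blast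
    qed
    then show "\<mu> \<le> \<bar>real (card {x \<in> ?J. F \<in> ?A x}) - \<mu>\<bar>"
      by (metis abs_ge_self abs_minus_commute card.empty diff_zero of_nat_0)
  qed auto
  also have "\<dots> \<le> ((\<Sum>x\<in>?J. \<Sum>y\<in>?J. measure_pmf.prob picks (?A x \<inter> ?A y)) - \<mu>\<^sup>2) / \<mu>\<^sup>2"
    using measure_pmf.prob_count_deviation_le[OF finJ _ \<mu>, of ?A picks] by (simp add: \<mu>_def)
  also have "\<dots> \<le> (\<mu> + m * T\<^sup>2 * q\<^sup>2) / \<mu>\<^sup>2"
    using second by (intro divide_right_mono) auto
  also have "\<dots> = 1 / \<mu> + m * T\<^sup>2 * q\<^sup>2 / \<mu>\<^sup>2"
    using \<mu> by (simp add: field_simps power2_eq_square)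
  also have "\<dots> \<le> 1 / (m * T * p_min) + m * T\<^sup>2 * q\<^sup>2 / (m * T * p_min)\<^sup>2"
    using \<mu>_ge mTp \<mu> m T p
    by (intro add_mono divide_left_mono power_mono mult_pos_pos zero_less_power) auto
  also have "m * T\<^sup>2 * q\<^sup>2 / (m * T * p_min)\<^sup>2 = (q / p_min)\<^sup>2 / m"
    using m T p by (simp add: field_simps power2_eq_square)
  finally show ?thesis by (simp add: m_def)
qed

end

section \<open>Cells and blocks of the unit cube\<close>

text \<open>The cubes of side length \<open>h\<close> of the lattice through the origin are indexed by integer
  vectors. With \<open>h = r / CARD('d)\<close>, points in the same cell are joined in the geometric graph, and
  joined points have cell indices that differ by at most \<open>CARD('d)\<close> in each coordinate.\<close>

definition cell_index :: "real \<Rightarrow> real ^ 'd \<Rightarrow> 'd \<Rightarrow> int" where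
  "cell_index h y = (\<lambda>i. \<lfloor>y $ i / h\<rfloor>)"

definition cell :: "real \<Rightarrow> ('d \<Rightarrow> int) \<Rightarrow> (real ^ 'd) set" where
  "cell h z = {y. cell_index h y = z}"

text \<open>Balls of integer vectors in the maximum norm.\<close>

definition near :: "nat \<Rightarrow> ('d \<Rightarrow> int) \<Rightarrow> ('d \<Rightarrow> int) set" where
  "near k z = {z'. \<forall>i. \<bar>z' i - z i\<bar> \<le> int k}"

lemma near_eq_PiE: "near k z = (\<Pi>\<^sub>E i\<in>UNIV. {z i - int k..z i + int k})"
proof -
  have "\<bar>z' i - z i\<bar> \<le> int k \<longleftrightarrow> z' i \<in> {z i - int k..z i + int k}" for z' i
    by auto
  then show ?thesis by (simp only: near_def PiE_UNIV_domain Pi_def) simp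
qed

lemma finite_near [simp]: "finite (near k (z :: 'd::finite \<Rightarrow> int))"
  unfolding near_eq_PiE by (intro finite_PiE) auto

lemma card_near: "card (near k (z :: 'd::finite \<Rightarrow> int)) = (2 * k + 1) ^ CARD('d)"
proof -
  have "nat (z i + int k + 1 - (z i - int k)) = 2 * k + 1" for i by simp
  then show ?thesis unfolding near_eq_PiE by (subst card_PiE) simp_all
qed

lemma dist_lt_if_same_cell:
  fixes h :: real and x y :: "real ^ 'd"
  assumes h: "0 < h" and eq: "cell_index h x = cell_index h y"
  shows "norm (x - y) < CARD('d) * h"
proof -
  have "\<bar>(x - y) $ i\<bar> < h" for i
  proof -
    have "\<lfloor>x $ i / h\<rfloor> = \<lfloor>y $ i / h\<rfloor>" using eq by (simp add: cell_index_def fun_eq_iff)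
    then have "\<bar>x $ i / h - y $ i / h\<bar> < 1" by linarith
    then have "\<bar>(x $ i - y $ i) / h\<bar> < 1" by (simp add: diff_divide_distrib)
    then show ?thesis using h by (simp add: abs_divide)
  qed
  then have "(\<Sum>i\<in>UNIV. \<bar>(x - y) $ i\<bar>) < (\<Sum>i\<in>(UNIV :: 'd set). h)"
    by (intro sum_strict_mono) auto
  then show ?thesis using norm_le_l1_cart[of "x - y"] by simp
qed

lemma near_if_dist_lt:
  fixes h :: real and x y :: "real ^ 'd"
  assumes h: "0 < h" and "norm (x - y) < real k * h"
  shows "cell_index h x \<in> near k (cell_index h y)"
proof -
  have "\<bar>\<lfloor>x $ i / h\<rfloor> - \<lfloor>y $ i / h\<rfloor>\<bar> \<le> int k" for i
  proof -
    have "\<bar>(x - y) $ i\<bar> < k * h" using component_le_norm_cart[of "x - y" i] assms by linarith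
    then have "\<bar>(x $ i - y $ i) / h\<bar> < k" using h by (simp add: abs_divide field_simps)
    then have "\<bar>x $ i / h - y $ i / h\<bar> < k" by (simp add: diff_divide_distrib)
    then show ?thesis by linarith
  qed
  then show ?thesis by (simp add: near_def cell_index_def)
qed

lemma near_add:
  assumes "a \<in> near k b" "b \<in> near l z"
  shows "a \<in> near (k + l) z"
proof -
  have "\<bar>a i - z i\<bar> \<le> int (k + l)" for i
  proof -
    have "\<bar>a i - b i\<bar> \<le> int k" "\<bar>b i - z i\<bar> \<le> int l" using assms by (auto simp: near_def)
    then show ?thesis by linarith
  qed
  then show ?thesis by (simp add: near_def)
qed

lemma near_mono: "k \<le> l \<Longrightarrow> near k z \<subseteq> near l z"
  by (auto simp: near_def intro: order_trans)

lemma cell_box: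
  fixes z :: "'d::finite \<Rightarrow> int"
  assumes "0 < h"
  shows "box (\<chi> i. of_int (z i) * h) (\<chi> i. (of_int (z i) + 1) * h) \<subseteq> cell h z"
    and "cell h z \<subseteq> cbox (\<chi> i. of_int (z i) * h) (\<chi> i. (of_int (z i) + 1) * h)"
proof -
  have floor: "\<lfloor>t / h\<rfloor> = k \<longleftrightarrow> of_int k * h \<le> t \<and> t < (of_int k + 1) * h" for t k
    using assms by (simp add: floor_eq_iff pos_le_divide_eq pos_divide_less_eq)
  have cell: "y \<in> cell h z \<longleftrightarrow> (\<forall>i. of_int (z i) * h \<le> y $ i \<and> y $ i < (of_int (z i) + 1) * h)" for y
    by (simp add: cell_def cell_index_def fun_eq_iff floor)
  show "box (\<chi> i. of_int (z i) * h) (\<chi> i. (of_int (z i) + 1) * h) \<subseteq> cell h z"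
    unfolding subset_eq cell by (auto simp: mem_box_cart) (meson less_imp_le)
  show "cell h z \<subseteq> cbox (\<chi> i. of_int (z i) * h) (\<chi> i. (of_int (z i) + 1) * h)"
    by (auto simp: cell mem_box_cart) (meson less_imp_le)
qed

lemma sets_cell [measurable]: "cell h (z :: 'd::finite \<Rightarrow> int) \<in> sets borel"
proof -
  have "cell h z = {y. \<forall>i. \<lfloor>y $ i / h\<rfloor> = z i}"
    by (auto simp: cell_def cell_index_def fun_eq_iff)
  also have "\<dots> \<in> sets borel" by measurable
  finally show ?thesis .
qed

lemma emeasure_cell:
  fixes z :: "'d::finite \<Rightarrow> int"
  assumes "0 < h"
  shows "emeasure lborel (cell h z) = h ^ CARD('d)"
proof -
  let ?a = "\<chi> i. of_int (z i) * h" and ?b = "\<chi> i. (of_int (z i) + 1) * h"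
  have le: "?a \<bullet> b \<le> ?b \<bullet> b" if "b \<in> Basis" for b :: "real ^ 'd"
    using assms that by (auto simp: Basis_vec_def inner_axis field_simps)
  have prod: "(\<Prod>b\<in>Basis. (?b - ?a) \<bullet> b) = h ^ CARD('d)"
  proof -
    have "(\<Prod>b\<in>Basis. (?b - ?a) \<bullet> b) = (\<Prod>b\<in>(Basis :: (real ^ 'd) set). h)"
      by (intro prod.cong) (auto simp: Basis_vec_def inner_axis algebra_simps)
    then show ?thesis by simp
  qed
  have "emeasure lborel (box ?a ?b) = h ^ CARD('d)" "emeasure lborel (cbox ?a ?b) = h ^ CARD('d)"
    unfolding prod[symmetric] using le by (auto simp: emeasure_lborel_box emeasure_lborel_cbox)
  moreover have "emeasure lborel (box ?a ?b) \<le> emeasure lborel (cell h z)"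
    "emeasure lborel (cell h z) \<le> emeasure lborel (cbox ?a ?b)"
    using cell_box[OF assms] by (auto intro!: emeasure_mono)
  ultimately show ?thesis by simp
qed

abbreviation uniform_cube :: "(real ^ 'd) measure" where
  "uniform_cube \<equiv> uniform_measure lborel unit_cube"

lemma measure_uniform_cell:
  fixes z :: "'d::finite \<Rightarrow> int"
  assumes h: "0 < h" and z: "\<And>i. 0 \<le> z i \<and> (of_int (z i) + 1) * h \<le> 1"
  shows "measure uniform_cube (cell h z) = h ^ CARD('d)"
proof -
  have sub: "cell h z \<subseteq> unit_cube"
  proof
    fix y assume "y \<in> cell h z"
    then have "y \<in> cbox (\<chi> i. of_int (z i) * h) (\<chi> i. (of_int (z i) + 1) * h)"
      using cell_box(2)[OF h] by blast
    then have y: "of_int (z i) * h \<le> y $ i \<and> y $ i \<le> (of_int (z i) + 1) * h" for i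
      by (simp add: mem_box_cart)
    have "0 \<le> y $ i \<and> y $ i \<le> 1" for i
    proof -
      have "0 \<le> of_int (z i) * h" using z[of i] h by simp
      then show ?thesis using y[of i] z[of i] by linarith
    qed
    then show "y \<in> unit_cube" by (simp add: unit_cube_def)
  qed
  have eq: "(unit_cube :: (real ^ 'd) set) = cbox 0 (\<chi> i. 1)"
    by (auto simp: unit_cube_def mem_box_cart)
  have one: "emeasure lborel (unit_cube :: (real ^ 'd) set) = 1"
    unfolding eq by (subst emeasure_lborel_cbox) (auto simp: Basis_vec_def inner_axis intro!: prod.neutral)
  have "unit_cube \<in> sets (lborel :: (real ^ 'd) measure)" unfolding eq by simp
  then have "emeasure uniform_cube (cell h z) = h ^ CARD('d)"
    using sub one emeasure_cell[OF h, of z] divide_ennreal[of "h ^ CARD('d)" 1] h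
    by (simp add: Int_absorb1)
  then show ?thesis using h by (simp add: measure_def)
qed

definition cell_count :: "nat \<Rightarrow> real \<Rightarrow> (nat \<Rightarrow> real ^ 'd) \<Rightarrow> ('d \<Rightarrow> int) \<Rightarrow> nat" where
  "cell_count n h x z = card {v \<in> {1..n}. cell_index h (x v) = z}"

definition well_filled :: "nat \<Rightarrow> real \<Rightarrow> (nat \<Rightarrow> real ^ 'd) \<Rightarrow> ('d \<Rightarrow> int) \<Rightarrow> bool" where
  "well_filled n h x z \<longleftrightarrow>
     \<bar>real (cell_count n h x z) - n * h ^ CARD('d)\<bar> < n * h ^ CARD('d) / 2"

lemma measurable_point:
  assumes "v \<in> {1..n}"
  shows "(\<lambda>x. x v) \<in> (uniform_points n :: (nat \<Rightarrow> real ^ 'd) measure) \<rightarrow>\<^sub>M borel"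
  using measurable_component_singleton[OF assms, of "\<lambda>_. uniform_cube"]
  by (simp add: uniform_points_def cong: measurable_cong_sets)

lemma measurable_cell_count [measurable]:
  "(\<lambda>x. cell_count n h x z) \<in> (uniform_points n :: (nat \<Rightarrow> real ^ 'd) measure) \<rightarrow>\<^sub>M count_space UNIV"
proof -
  have "Measurable.pred (uniform_points n) (\<lambda>x. cell_index h (x v) = z)" if "v \<in> {1..n}" for v
  proof -
    have "(\<lambda>x. x v \<in> cell h z) \<in> uniform_points n \<rightarrow>\<^sub>M count_space UNIV"
      using measurable_point[OF that] by measurable
    then show ?thesis by (simp add: cell_def)
  qed
  then show ?thesis
    unfolding cell_count_def by (intro measurable_card) auto
qed

lemma measurable_well_filled [measurable]:
  "Measurable.pred (uniform_points n :: (nat \<Rightarrow> real ^ 'd) measure) (\<lambda>x. well_filled n h x z)"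
  unfolding well_filled_def by measurable

text \<open>The number of points in a cell is binomially distributed; its mean is
  \<open>n * h ^ CARD('d)\<close> and its variance is smaller, so a deviation by half of the mean is unlikely
  once the mean is large.\<close>

lemma prob_not_well_filled:
  fixes z :: "'d::finite \<Rightarrow> int"
  assumes h: "0 < h" and z: "\<And>i. 0 \<le> z i \<and> (of_int (z i) + 1) * h \<le> 1" and n: "0 < n"
  defines "M \<equiv> (uniform_points n :: (nat \<Rightarrow> real ^ 'd) measure)"
  shows "measure M {x \<in> space M. \<not> well_filled n h x z} \<le> 4 / (n * h ^ CARD('d))"
proof -
  interpret prob_space M unfolding M_def by (rule prob_space_uniform_points)
  interpret U: prob_space "uniform_cube :: (real ^ 'd) measure" by (rule prob_space_uniform_cube)
  interpret P: product_prob_space "\<lambda>_. uniform_cube :: (real ^ 'd) measure" "{1..n}" ..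
  let ?p = "h ^ CARD('d)"
  have p: "?p > 0" using h by simp
  let ?A = "\<lambda>v. {x \<in> space M. x v \<in> cell h z}"
  have Asets: "?A v \<in> events" if "v \<in> {1..n}" for v
    using measurable_point[OF that, where ?'d = 'd] unfolding M_def by measurable
  have cyl: "prob {x \<in> space M. \<forall>v\<in>J. x v \<in> cell h z} = ?p ^ card J" if J: "J \<subseteq> {1..n}" for J
  proof -
    have "finite J" using J finite_subset by blast
    have "emeasure M {x \<in> space M. \<forall>v\<in>J. x v \<in> cell h z} = (\<Prod>v\<in>J. emeasure uniform_cube (cell h z))"
      unfolding M_def uniform_points_def using J \<open>finite J\<close> by (intro P.emeasure_PiM_Collect) auto
    also have "\<dots> = ennreal (?p ^ card J)"
      using measure_uniform_cell[OF h, of z] z p by (simp add: U.emeasure_eq_measure ennreal_power)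
    finally show ?thesis using p by (simp add: measure_def)
  qed
  have one: "prob (?A v) = ?p" if "v \<in> {1..n}" for v
    using cyl[of "{v}"] that by simp
  have two: "prob (?A v \<inter> ?A w) = (if v = w then ?p else ?p\<^sup>2)" if "v \<in> {1..n}" "w \<in> {1..n}" for v w
  proof (cases "v = w")
    case True
    then show ?thesis using one that by simp
  next
    case False
    have "?A v \<inter> ?A w = {x \<in> space M. \<forall>u\<in>{v, w}. x u \<in> cell h z}" by auto
    then show ?thesis using cyl[of "{v, w}"] that False by (simp add: power2_eq_square)
  qed
  have mean: "(\<Sum>v\<in>{1..n}. prob (?A v)) = n * ?p" using one by simp
  have "(\<Sum>v\<in>{1..n}. \<Sum>w\<in>{1..n}. prob (?A v \<inter> ?A w))
      \<le> (\<Sum>v\<in>{1..n}. \<Sum>w\<in>{1..n}. ?p\<^sup>2 + (if v = w then ?p else 0))"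
    using two p by (intro sum_mono) auto
  also have "\<dots> = (n * ?p)\<^sup>2 + n * ?p" by (simp add: sum.distrib power2_eq_square algebra_simps)
  finally have second: "(\<Sum>v\<in>{1..n}. \<Sum>w\<in>{1..n}. prob (?A v \<inter> ?A w)) - (n * ?p)\<^sup>2 \<le> n * ?p" by simp
  have t: "0 < n * ?p / 2" using n p by simp
  have count: "cell_count n h x z = card {v \<in> {1..n}. x \<in> ?A v}" if "x \<in> space M" for x
    using that by (simp add: cell_count_def cell_def)
  have "{x \<in> space M. \<not> well_filled n h x z} = {x \<in> space M. n * ?p / 2 \<le>
      \<bar>real (card {v \<in> {1..n}. x \<in> ?A v}) - (\<Sum>v\<in>{1..n}. prob (?A v))\<bar>}"
    unfolding mean well_filled_def not_less using count by auto
  also have "prob \<dots> \<le> ((\<Sum>v\<in>{1..n}. \<Sum>w\<in>{1..n}. prob (?A v \<inter> ?A w))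
      - (\<Sum>v\<in>{1..n}. prob (?A v))\<^sup>2) / (n * ?p / 2)\<^sup>2"
    by (rule prob_count_deviation_le[OF _ Asets t]) auto
  also have "\<dots> \<le> n * ?p / (n * ?p / 2)\<^sup>2"
    unfolding mean using second by (intro divide_right_mono) auto
  also have "\<dots> = 4 / (n * ?p)" using t by (simp add: field_simps power2_eq_square)
  finally show ?thesis .
qed

text \<open>The lattice is divided into blocks of \<open>5 * CARD('d)\<close> cells per coordinate. The clique is
  sought in the cell at \<open>block_centre\<close>; its neighbours are at most \<open>CARD('d)\<close> cells away, and
  their neighbours at most \<open>2 * CARD('d)\<close>, which stays inside the block.\<close>

definition block_centre :: "('d \<Rightarrow> int) \<Rightarrow> 'd::finite \<Rightarrow> int" where
  "block_centre b = (\<lambda>i. 5 * int CARD('d) * b i + 2 * int CARD('d))"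

definition good_block :: "nat \<Rightarrow> real \<Rightarrow> (nat \<Rightarrow> real ^ 'd) \<Rightarrow> ('d \<Rightarrow> int) \<Rightarrow> bool" where
  "good_block n h x b \<longleftrightarrow> (\<forall>z\<in>near (2 * CARD('d)) (block_centre b). well_filled n h x z)"

definition blocks :: "nat \<Rightarrow> ('d::finite \<Rightarrow> int) set" where
  "blocks m = (\<Pi>\<^sub>E i\<in>UNIV. {0..<int m})"

lemma finite_blocks [simp]: "finite (blocks m :: ('d::finite \<Rightarrow> int) set)"
  unfolding blocks_def by (intro finite_PiE) auto

lemma card_blocks: "card (blocks m :: ('d::finite \<Rightarrow> int) set) = m ^ CARD('d)"
  unfolding blocks_def by (subst card_PiE) simp_all

lemma measurable_good_block [measurable]:
  "Measurable.pred (uniform_points n :: (nat \<Rightarrow> real ^ 'd) measure) (\<lambda>x. good_block n h x b)"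
  unfolding good_block_def by (intro pred_intros_finite) auto

lemma prob_bad_block:
  fixes h :: real and m n :: nat and b :: "'d::finite \<Rightarrow> int"
  assumes h: "0 < h" and b: "b \<in> blocks m" and m: "5 * CARD('d) * m * h \<le> 1" and n: "0 < n"
  defines "M \<equiv> (uniform_points n :: (nat \<Rightarrow> real ^ 'd) measure)"
  shows "measure M {x \<in> space M. \<not> good_block n h x b}
    \<le> (4 * CARD('d) + 1) ^ CARD('d) * (4 / (n * h ^ CARD('d)))"
proof -
  interpret prob_space M unfolding M_def by (rule prob_space_uniform_points)
  let ?N = "near (2 * CARD('d)) (block_centre b)"
  have inside: "0 \<le> z i \<and> (of_int (z i) + 1) * h \<le> 1" if z: "z \<in> ?N" for z i
  proof -
    have "b i \<in> {0..<int m}" using b by (simp add: blocks_def PiE_iff)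
    then have bi: "0 \<le> b i" "b i + 1 \<le> int m" by auto
    have zi: "5 * int CARD('d) * b i \<le> z i" "z i \<le> 5 * int CARD('d) * b i + 4 * int CARD('d)"
      using z by (auto simp: near_def block_centre_def abs_le_iff algebra_simps dest!: spec[of _ i])
    have d: "1 \<le> int CARD('d)" by (simp add: Suc_le_eq)
    have "5 * int CARD('d) * (b i + 1) \<le> 5 * int CARD('d) * int m"
      using bi by (intro mult_left_mono) auto
    moreover have "5 * int CARD('d) * (b i + 1) = 5 * int CARD('d) * b i + 5 * int CARD('d)"
      by (simp add: algebra_simps)
    ultimately have "z i + 1 \<le> 5 * int CARD('d) * int m" using zi d by linarith
    then have "real_of_int (z i) + 1 \<le> 5 * CARD('d) * m"
      by (metis of_int_1 of_int_add of_int_le_iff of_int_mult of_int_numeral of_int_of_nat_eq of_nat_mult of_nat_numeral)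
    then have "(real_of_int (z i) + 1) * h \<le> 5 * CARD('d) * m * h"
      using h by (intro mult_right_mono) auto
    moreover have "0 \<le> 5 * int CARD('d) * b i" using bi by simp
    ultimately show ?thesis using zi m by linarith
  qed
  have "{x \<in> space M. \<not> good_block n h x b} = (\<Union>z\<in>?N. {x \<in> space M. \<not> well_filled n h x z})"
    by (auto simp: good_block_def)
  also have "prob \<dots> \<le> (\<Sum>z\<in>?N. prob {x \<in> space M. \<not> well_filled n h x z})"
    unfolding M_def by (intro measure_UNION_le) auto
  also have "\<dots> \<le> (\<Sum>z\<in>?N. 4 / (n * h ^ CARD('d)))"
    unfolding M_def using inside by (intro sum_mono prob_not_well_filled h n) auto
  also have "\<dots> = (4 * CARD('d) + 1) ^ CARD('d) * (4 / (n * h ^ CARD('d)))"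
    by (simp add: card_near)
  finally show ?thesis .
qed

text \<open>A given block is good with probability close to \<open>1\<close>, but in general not close enough
  for all blocks to be good at once. Markov's inequality for the number of bad blocks shows that
  half of the blocks are good, which is enough for the count of isolated cliques.\<close>

lemma prob_few_good_blocks:
  fixes h :: real and m n :: nat
  assumes h: "0 < h" and m: "5 * CARD('d::finite) * m * h \<le> 1" "0 < m" and n: "0 < n"
  defines "M \<equiv> (uniform_points n :: (nat \<Rightarrow> real ^ 'd) measure)"
  shows "measure M {x \<in> space M. 2 * card {b \<in> blocks m. good_block n h x b} < m ^ CARD('d)}
    \<le> (4 * CARD('d) + 1) ^ CARD('d) * (8 / (n * h ^ CARD('d)))"
proof -
  interpret prob_space M unfolding M_def by (rule prob_space_uniform_points)
  let ?B = "blocks m :: ('d \<Rightarrow> int) set"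
  let ?bad = "\<lambda>b. {x \<in> space M. \<not> good_block n h x b}"
  let ?u = "\<lambda>x. \<Sum>b\<in>?B. indicat_real (?bad b) x"
  let ?q = "(4 * CARD('d) + 1) ^ CARD('d) * (4 / (n * h ^ CARD('d)))"
  have sets: "?bad b \<in> events" for b unfolding M_def by measurable
  have int: "integrable M (indicat_real (?bad b))" for b
    using sets by (simp add: emeasure_eq_measure)
  have "prob {x \<in> space M. 2 * card {b \<in> ?B. good_block n h x b} < m ^ CARD('d)}
      \<le> prob {x \<in> space M. real (m ^ CARD('d)) / 2 \<le> ?u x}"
  proof (intro finite_measure_mono subsetI)
    show "{x \<in> space M. real (m ^ CARD('d)) / 2 \<le> ?u x} \<in> events"
      using sets by measurable
    fix x assume x: "x \<in> {x \<in> space M. 2 * card {b \<in> ?B. good_block n h x b} < m ^ CARD('d)}"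
    have "?u x = real (card {b \<in> ?B. \<not> good_block n h x b})"
      using x by (simp add: indicator_def sum.If_cases Int_def)
    moreover have "card ?B = card {b \<in> ?B. good_block n h x b} + card {b \<in> ?B. \<not> good_block n h x b}"
      by (subst card_Un_disjoint[symmetric]) (auto intro: arg_cong[where f = card])
    ultimately have "real (m ^ CARD('d)) / 2 \<le> ?u x"
      using x card_blocks[of m, where ?'d = 'd] by (simp add: field_simps)
    then show "x \<in> {x \<in> space M. real (m ^ CARD('d)) / 2 \<le> ?u x}" using x by simp
  qed
  also have "\<dots> \<le> expectation ?u / (real (m ^ CARD('d)) / 2)"
    using int m by (intro integral_Markov_inequality_measure[where A = "space M"])
      (auto intro!: Bochner_Integration.integrable_sum sum_nonneg)
  also have "expectation ?u = (\<Sum>b\<in>?B. prob (?bad b))"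
    using int sets by (subst Bochner_Integration.integral_sum) (auto intro!: sum.cong)
  also have "\<dots> / (real (m ^ CARD('d)) / 2) \<le> (\<Sum>b\<in>?B. ?q) / (real (m ^ CARD('d)) / 2)"
    unfolding M_def using prob_bad_block[OF h _ m(1) n]
    by (intro divide_right_mono sum_mono) auto
  also have "\<dots> = (4 * CARD('d) + 1) ^ CARD('d) * (8 / (n * h ^ CARD('d)))"
    using m by (simp add: card_blocks field_simps)
  finally show ?thesis .
qed

section \<open>From random points to crowded sites\<close>

lemma geometric_edge_iff:
  "{u, v} \<in> geometric_edges n r x \<longleftrightarrow> u \<in> {1..n} \<and> v \<in> {1..n} \<and> u \<noteq> v \<and> norm (x u - x v) < r"
  by (auto simp: geometric_edges_def doubleton_eq_iff norm_minus_commute)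

lemma card_incident_geometric:
  assumes "v \<in> {1..n}"
  shows "card (incident_edges (geometric_edges n r x) v) =
    card {w \<in> {1..n}. w \<noteq> v \<and> norm (x v - x w) < r}"
proof -
  let ?N = "{w \<in> {1..n}. w \<noteq> v \<and> norm (x v - x w) < r}"
  have "incident_edges (geometric_edges n r x) v = (\<lambda>w. {v, w}) ` ?N"
  proof (intro set_eqI iffI)
    fix e assume "e \<in> incident_edges (geometric_edges n r x) v"
    then have e: "e \<in> geometric_edges n r x" "v \<in> e" by (auto simp: incident_edges_def)
    then obtain a b where ab: "e = {a, b}" "a \<in> {1..n}" "b \<in> {1..n}" "a \<noteq> b" "norm (x a - x b) < r"
      unfolding geometric_edges_def by blast
    with e(2) consider "v = a" | "v = b" by blast
    then show "e \<in> (\<lambda>w. {v, w}) ` ?N"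
    proof cases
      case 1
      then show ?thesis using ab by auto
    next
      case 2
      then have "e = {v, a}" "a \<in> ?N" using ab by (auto simp: norm_minus_commute)
      then show ?thesis by blast
    qed
  next
    fix e assume "e \<in> (\<lambda>w. {v, w}) ` ?N"
    then show "e \<in> incident_edges (geometric_edges n r x) v"
      using assms by (auto simp: incident_edges_def geometric_edge_iff)
  qed
  then show ?thesis by (simp add: card_image inj_on_def doubleton_eq_iff)
qed

lemma card_points_in_cells:
  assumes "finite Z"
  shows "card {v \<in> {1..n}. cell_index h (x v) \<in> Z} = (\<Sum>z\<in>Z. cell_count n h x z)"
proof -
  have "{v \<in> {1..n}. cell_index h (x v) \<in> Z} = (\<Union>z\<in>Z. {v \<in> {1..n}. cell_index h (x v) = z})"
    by auto
  then show ?thesis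
    unfolding cell_count_def using assms by (simp add: card_UN_disjoint disjoint_iff)
qed

lemma card_points_near_le:
  fixes h :: real and x :: "nat \<Rightarrow> real ^ 'd"
  assumes good: "good_block n h x b" and h: "0 \<le> h"
  shows "real (card {v \<in> {1..n}. cell_index h (x v) \<in> near (2 * CARD('d)) (block_centre b)})
    \<le> (4 * CARD('d) + 1) ^ CARD('d) * (2 * (n * h ^ CARD('d)))"
proof -
  let ?N = "near (2 * CARD('d)) (block_centre b)"
  let ?s = "n * h ^ CARD('d)"
  have "real (card {v \<in> {1..n}. cell_index h (x v) \<in> ?N}) = real (\<Sum>z\<in>?N. cell_count n h x z)"
    by (simp only: card_points_in_cells[OF finite_near])
  also have "\<dots> \<le> (\<Sum>z\<in>?N. 2 * ?s)"
    unfolding of_nat_sum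
  proof (rule sum_mono)
    fix z assume "z \<in> ?N"
    then have "well_filled n h x z" using good by (simp add: good_block_def)
    moreover have "0 \<le> ?s" using h by simp
    ultimately show "real (cell_count n h x z) \<le> 2 * ?s"
      unfolding well_filled_def by linarith
  qed
  also have "(\<Sum>z\<in>?N. 2 * ?s) = (4 * CARD('d) + 1) ^ CARD('d) * (2 * ?s)"
    by (simp add: card_near)
  finally show ?thesis .
qed

lemma block_centre_unique:
  fixes b b' :: "'d::finite \<Rightarrow> int"
  assumes "z \<in> near CARD('d) (block_centre b)" "z \<in> near CARD('d) (block_centre b')"
  shows "b = b'"
proof
  fix i
  let ?d = "int CARD('d)"
  have d: "1 \<le> ?d" by (simp add: Suc_le_eq)
  have "\<bar>z i - block_centre b i\<bar> \<le> ?d" "\<bar>z i - block_centre b' i\<bar> \<le> ?d"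
    using assms by (auto simp: near_def)
  then have "\<bar>block_centre b i - block_centre b' i\<bar> \<le> 2 * ?d" by linarith
  moreover have "block_centre b i - block_centre b' i = 5 * ?d * (b i - b' i)"
    by (simp add: block_centre_def algebra_simps)
  ultimately have le: "5 * ?d * \<bar>b i - b' i\<bar> \<le> 2 * ?d" using d by (simp add: abs_mult)
  show "b i = b' i"
  proof (rule ccontr)
    assume "b i \<noteq> b' i"
    then have "1 \<le> \<bar>b i - b' i\<bar>" by linarith
    then have "5 * ?d * 1 \<le> 5 * ?d * \<bar>b i - b' i\<bar>" using d by (intro mult_left_mono) auto
    then show False using le d by linarith
  qed
qed

text \<open>The good blocks are the sites: the central cell of a good block contains at least \<open>L\<close> points,
  and all vertices within \<open>CARD('d)\<close> cells of it have at least the other points of their own cell and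
  at most all points of the block as neighbours.\<close>

lemma prob_connected_given_points:
  fixes x :: "nat \<Rightarrow> real ^ 'd" and r h s :: real and n m c L D2 :: nat
  assumes r: "0 < r"
  defines "h \<equiv> r / CARD('d)"
  defines "s \<equiv> n * h ^ CARD('d)"
  defines "L \<equiv> nat \<lceil>s / 2\<rceil>" and "D2 \<equiv> nat \<lfloor>(4 * CARD('d) + 1) ^ CARD('d) * (2 * s)\<rfloor>"
  defines "G \<equiv> {b \<in> blocks m. good_block n h x b}"
  assumes c: "4 * (c + 1) \<le> L - 1" and cn: "c + 1 < n" and G: "G \<noteq> {}"
  shows "measure_pmf.prob (irrigation_pmf n c (geometric_edges n r x)) {E'. connected_graph {1..n} E'}
    \<le> 1 / (card G * real (L choose (c + 1)) * isolation_bound c (L - 1) D2)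
      + ((1 / real ((L - 1) choose c)) ^ (c + 1) / isolation_bound c (L - 1) D2)\<^sup>2 / card G"
proof -
  let ?d = "CARD('d)"
  let ?idx = "\<lambda>v. cell_index h (x v)"
  have h: "0 < h" unfolding h_def using r by simp
  have dh: "?d * h = r" unfolding h_def by simp
  define W where "W = (\<lambda>b. {v \<in> {1..n}. ?idx v \<in> near ?d (block_centre b)})"
  define W2 where "W2 = (\<lambda>b. {v \<in> {1..n}. ?idx v \<in> near (2 * ?d) (block_centre b)})"
  have s0: "0 \<le> s" unfolding s_def using h by simp
  have count_ge: "L \<le> cell_count n h x z" if "b \<in> G" "z \<in> near (2 * ?d) (block_centre b)" for b z
  proof -
    have "well_filled n h x z" using that by (simp add: G_def good_block_def)
    then have "s / 2 \<le> cell_count n h x z" unfolding well_filled_def s_def by linarith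
    then show ?thesis unfolding L_def by linarith
  qed
  have W2_le: "card (W2 b) \<le> D2" if "b \<in> G" for b
  proof -
    have "real (card (W2 b)) \<le> (4 * ?d + 1) ^ ?d * (2 * s)"
      unfolding W2_def s_def using that h by (intro card_points_near_le) (auto simp: G_def)
    then show ?thesis unfolding D2_def by linarith
  qed
  have "\<exists>Q. Q \<subseteq> {v \<in> {1..n}. ?idx v = block_centre b} \<and> card Q = L" if "b \<in> G" for b
  proof -
    have "block_centre b \<in> near (2 * ?d) (block_centre b)" by (simp add: near_def)
    from count_ge[OF that this] have "L \<le> card {v \<in> {1..n}. ?idx v = block_centre b}"
      by (simp add: cell_count_def)
    then obtain Q where "Q \<subseteq> {v \<in> {1..n}. ?idx v = block_centre b}" "card Q = L"
      by (rule obtain_subset_with_card_n)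
    then show ?thesis by blast
  qed
  then have "\<exists>Q. \<forall>b\<in>G. Q b \<subseteq> {v \<in> {1..n}. ?idx v = block_centre b} \<and> card (Q b) = L"
    by (intro bchoice) blast
  then obtain Q where Q: "\<And>b. b \<in> G \<Longrightarrow> Q b \<subseteq> {v \<in> {1..n}. ?idx v = block_centre b}"
    and cardQ: "\<And>b. b \<in> G \<Longrightarrow> card (Q b) = L"
    by blast
  have near_idx: "?idx u \<in> near ?d (?idx v)" if "norm (x u - x v) < r" for u v
    using near_if_dist_lt[OF h, of "x u" "x v" ?d] that dh by simp
  interpret crowded_sites n c L "L - 1" D2 "geometric_edges n r x" G Q W
  proof
    show "finite G" by (simp add: G_def)
    show "G \<noteq> {}" by (rule G)
    show "\<exists>u\<in>{1..n}. \<exists>v\<in>{1..n}. u \<noteq> v \<and> e = {u, v}" if "e \<in> geometric_edges n r x" for e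
      using that unfolding geometric_edges_def by blast
    show "Q b \<subseteq> W b" if "b \<in> G" for b
      using Q[OF that] unfolding W_def by (auto simp: near_def)
    show "W b \<subseteq> {1..n}" for b by (auto simp: W_def)
    show "{u, v} \<in> geometric_edges n r x" if "b \<in> G" "u \<in> Q b" "v \<in> Q b" "u \<noteq> v" for b u v
    proof -
      have "u \<in> {1..n}" "v \<in> {1..n}" "?idx u = ?idx v" 
        using subsetD[OF Q[OF that(1)] that(2)] subsetD[OF Q[OF that(1)] that(3)] by auto
      then show ?thesis
        using dist_lt_if_same_cell[OF h, of "x u" "x v"] that(4) dh by (simp add: geometric_edge_iff)
    qed
    show "v \<in> W b" if "b \<in> G" "{u, v} \<in> geometric_edges n r x" "u \<in> Q b" for b u v
    proof -
      have uv: "v \<in> {1..n}" "norm (x v - x u) < r"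
        using that(2) by (auto simp: geometric_edge_iff norm_minus_commute)
      have "?idx u = block_centre b" using Q[OF that(1)] that(3) by blast
      then show ?thesis using near_idx[OF uv(2)] uv(1) by (simp add: W_def)
    qed
    show "W b \<inter> W b' = {}" if "b \<noteq> b'" for b b'
      using block_centre_unique that unfolding W_def by blast
    show "card (Q b) = L" if "b \<in> G" for b by (rule cardQ[OF that])
    show "card (W b) \<le> D2" if "b \<in> G" for b
    proof -
      have "W b \<subseteq> W2 b" using near_mono[of ?d "2 * ?d"] by (auto simp: W_def W2_def)
      then have "card (W b) \<le> card (W2 b)" by (intro card_mono) (auto simp: W2_def)
      then show ?thesis using W2_le[OF that] by linarith
    qed
    show "L - 1 \<le> card (incident_edges (geometric_edges n r x) v) \<and>
        card (incident_edges (geometric_edges n r x) v) \<le> D2" if "b \<in> G" "v \<in> W b" for b v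
    proof -
      let ?N = "{w \<in> {1..n}. w \<noteq> v \<and> norm (x v - x w) < r}"
      let ?C = "{w \<in> {1..n}. ?idx w = ?idx v}"
      have v: "v \<in> {1..n}" "?idx v \<in> near ?d (block_centre b)" using that(2) by (auto simp: W_def)
      have "?idx v \<in> near (2 * ?d) (block_centre b)" using v(2) near_mono[of ?d "2 * ?d"] by auto
      then have "L \<le> card ?C" using count_ge[OF that(1)] by (simp add: cell_count_def)
      moreover have "?C - {v} \<subseteq> ?N"
        using dist_lt_if_same_cell[OF h, of "x v"] dh by auto
      then have "card (?C - {v}) \<le> card ?N" by (intro card_mono) auto
      moreover have "card (?C - {v}) = card ?C - 1" using v by simp
      moreover have "?N \<subseteq> W2 b"
      proof
        fix w assume w: "w \<in> ?N"
        then have "?idx w \<in> near ?d (?idx v)" by (intro near_idx) (simp add: norm_minus_commute)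
        from near_add[OF this v(2)] w show "w \<in> W2 b" by (simp add: W2_def mult_2)
      qed
      then have "card ?N \<le> D2"
        using W2_le[OF that(1)] card_mono[of "W2 b" ?N] by (simp add: W2_def)
      ultimately show ?thesis unfolding card_incident_geometric[OF v(1)] by linarith
    qed
    show "c + 1 \<le> L" using c by arith
    show "4 * (c + 1) \<le> L - 1" by (rule c)
    show "c + 1 < n" by (rule cn)
  qed
  show ?thesis by (rule prob_connected_le)
qed

text \<open>Averaging the previous bound over the points; the configurations with too few good blocks
  are given up entirely.\<close>

lemma prob_disconnected_ge:
  fixes r h s k :: real and n m c L D2 :: nat
  assumes r: "0 < r" and m: "5 * m * r \<le> 1" "0 < m"
  defines "h \<equiv> r / CARD('d::finite)"
  defines "s \<equiv> n * h ^ CARD('d)"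
  defines "L \<equiv> nat \<lceil>s / 2\<rceil>" and "D2 \<equiv> nat \<lfloor>(4 * CARD('d) + 1) ^ CARD('d) * (2 * s)\<rfloor>"
  defines "k \<equiv> real (m ^ CARD('d)) / 2"
  assumes c: "4 * (c + 1) \<le> L - 1" and cn: "c + 1 < n"
  shows "measure (irrigation_graph TYPE('d) n r c) {E. \<not> connected_graph {1..n} E}
    \<ge> 1 - (4 * CARD('d) + 1) ^ CARD('d) * (8 / s)
        - 1 / (k * real (L choose (c + 1)) * isolation_bound c (L - 1) D2)
        - ((1 / real ((L - 1) choose c)) ^ (c + 1) / isolation_bound c (L - 1) D2)\<^sup>2 / k"
proof -
  let ?M = "uniform_points n :: (nat \<Rightarrow> real ^ 'd) measure"
  let ?K = "\<lambda>x. irrigation_pmf n c (geometric_edges n r (x :: nat \<Rightarrow> real ^ 'd))"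
  let ?C = "{E. connected_graph {1..n} E}"
  let ?few = "{x \<in> space ?M. 2 * card {b \<in> blocks m. good_block n h x b} < m ^ CARD('d)}"
  let ?p = "isolation_bound c (L - 1) D2"
  let ?\<delta> = "1 / (k * real (L choose (c + 1)) * ?p) + ((1 / real ((L - 1) choose c)) ^ (c + 1) / ?p)\<^sup>2 / k"
  interpret prob_space ?M by (rule prob_space_uniform_points)
  have h: "0 < h" unfolding h_def using r by simp
  have k: "0 < k" unfolding k_def using m by simp
  have n: "0 < n" using cn by simp
  have p0: "0 \<le> ?p" unfolding isolation_bound_def by simp
  have \<delta>0: "0 \<le> ?\<delta>" using k p0 by simp
  have "real (card {b \<in> blocks m. good_block n h x b}) =
      (\<Sum>b\<in>blocks m. if good_block n h x b then 1 else 0)" for x :: "nat \<Rightarrow> real ^ 'd"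
    by (simp add: sum.If_cases Int_def)
  then have "?few = {x \<in> space ?M.
      2 * (\<Sum>b\<in>blocks m. if good_block n h x b then 1 else 0) < real (m ^ CARD('d))}"
    by (metis (no_types, lifting) of_nat_less_iff of_nat_mult of_nat_numeral)
  also have "\<dots> \<in> events" by measurable
  finally have few_sets: "?few \<in> events" .
  have "5 * CARD('d) * m * h \<le> 1" using m unfolding h_def by simp
  then have few: "prob ?few \<le> (4 * CARD('d) + 1) ^ CARD('d) * (8 / s)"
    unfolding s_def using prob_few_good_blocks[OF h _ m(2) n, where ?'d = 'd] by simp
  have point: "measure_pmf.prob (?K x) ?C \<le> indicat_real ?few x + ?\<delta>" if x: "x \<in> space ?M" for x
  proof (cases "x \<in> ?few")
    case True
    then have "indicat_real ?few x = 1" by simp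
    then show ?thesis using \<delta>0 measure_pmf.prob_le_1[of "?K x" ?C] by linarith
  next
    case False
    let ?G = "{b \<in> blocks m. good_block n h x b}"
    have ge: "k \<le> card ?G" using False x unfolding k_def by (simp add: field_simps not_less flip: of_nat_power)
    then have "?G \<noteq> {}" using k by force
    then have "measure_pmf.prob (?K x) ?C \<le> 1 / (card ?G * real (L choose (c + 1)) * ?p)
      + ((1 / real ((L - 1) choose c)) ^ (c + 1) / ?p)\<^sup>2 / card ?G"
      using prob_connected_given_points[OF r, of c n m x] c cn unfolding h_def s_def L_def D2_def by simp
    also have "\<dots> \<le> ?\<delta>"
    proof (intro add_mono)
      have "1 / (card ?G * y) \<le> 1 / (k * y)" if "0 \<le> y" for y :: real
        using ge k that by (cases "y = 0") (auto intro!: frac_le mult_right_mono mult_pos_pos)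
      from this[of "real (L choose (c + 1)) * ?p"]
      show "1 / (card ?G * real (L choose (c + 1)) * ?p) \<le> 1 / (k * real (L choose (c + 1)) * ?p)"
        using p0 by (simp only: mult.assoc) simp
      show "((1 / real ((L - 1) choose c)) ^ (c + 1) / ?p)\<^sup>2 / card ?G
          \<le> ((1 / real ((L - 1) choose c)) ^ (c + 1) / ?p)\<^sup>2 / k"
        using ge k by (intro divide_left_mono mult_pos_pos) auto
    qed
    finally show ?thesis using False by simp
  qed
  have kernel: "(\<lambda>x. measure_pmf (?K x)) \<in> ?M \<rightarrow>\<^sub>M subprob_algebra (count_space UNIV)"
    by (rule measurable_prob_algebraD[OF measurable_irrigation_kernel])
  have "measure (irrigation_graph TYPE('d) n r c) ?C = expectation (\<lambda>x. measure_pmf.prob (?K x) ?C)"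
    unfolding irrigation_graph_def using kernel by (subst measure_bind) auto
  also have "\<dots> \<le> expectation (\<lambda>x. indicat_real ?few x + ?\<delta>)"
  proof (rule integral_mono)
    have "(\<lambda>x. measure_pmf.prob (?K x) ?C) \<in> borel_measurable ?M"
      using kernel by measurable
    then show "integrable ?M (\<lambda>x. measure_pmf.prob (?K x) ?C)"
      by (intro integrable_const_bound[where B = 1]) auto
    show "integrable ?M (\<lambda>x. indicat_real ?few x + ?\<delta>)"
      using few_sets by (simp add: emeasure_eq_measure)
  qed (rule point)
  also have "\<dots> = prob ?few + ?\<delta>"
    using few_sets by (subst Bochner_Integration.integral_add) (auto simp: emeasure_eq_measure prob_space)
  finally have conn: "measure (irrigation_graph TYPE('d) n r c) ?C \<le> prob ?few + ?\<delta>" .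
  interpret S: prob_space "irrigation_graph TYPE('d) n r c" by (rule prob_space_irrigation_graph)
  have "measure (irrigation_graph TYPE('d) n r c) {E. \<not> connected_graph {1..n} E}
      = 1 - measure (irrigation_graph TYPE('d) n r c) ?C"
  proof -
    have "space (irrigation_graph TYPE('d) n r c) = UNIV"
      using sets_irrigation_graph[where ?'d = 'd] sets_eq_imp_space_eq[of "irrigation_graph TYPE('d) n r c" "count_space UNIV"]
      by simp
    then show ?thesis
      using S.prob_compl[of ?C] by (simp add: sets_irrigation_graph Compl_eq_Diff_UNIV[symmetric] Collect_neg_eq)
  qed
  then show ?thesis using conn few by linarith
qed

section \<open>The order of magnitude of the number of isolated cliques\<close>

text \<open>The two usual estimates \<open>(s / c) ^ c\<close> and \<open>(exp 1 * s / c) ^ c\<close> of a binomial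
  coefficient, in exponential form. For the numbers below, the gap between them contributes a
  factor \<open>exp (O (c\<^sup>2))\<close>, which is negligible.\<close>

lemma binomial_le_exp:
  assumes "0 < c" and s: "0 < s" and D: "real D \<le> s"
  shows "real (D choose c) \<le> exp (c * (1 + ln s - ln c))"
proof -
  have "(\<Sum>n\<in>{c}. real c ^ n /\<^sub>R fact n) \<le> exp (real c)"
    unfolding exp_def by (intro sum_le_suminf summable_exp_generic) auto
  then have fact: "real c ^ c \<le> exp (real c) * fact c"
    by (simp add: field_simps)
  have "real (D choose c) * real c ^ c \<le> real (D choose c) * (exp (real c) * fact c)"
    using fact by (intro mult_left_mono) auto
  also have "\<dots> = exp (real c) * real ((D choose c) * fact c)" by simp
  also have "\<dots> \<le> exp (real c) * real (D ^ c)"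
    using binomial_fact_pow[of D c] by (intro mult_left_mono) (simp_all only: of_nat_le_iff exp_ge_zero)
  also have "\<dots> \<le> exp (real c) * s ^ c"
    using D by (auto intro!: power_mono)
  also have "\<dots> = exp (c * (1 + ln s - ln c)) * real c ^ c"
  proof -
    have "s ^ c = exp (c * ln s)" "real c ^ c = exp (c * ln c)"
      using s \<open>0 < c\<close> by (simp_all add: exp_of_nat_mult)
    then show ?thesis by (simp add: exp_add[symmetric] algebra_simps)
  qed
  finally show ?thesis using \<open>0 < c\<close> by simp
qed

lemma binomial_ge_exp:
  assumes "0 < c" and s: "0 < s" and D: "s \<le> real D" and "c \<le> D"
  shows "exp (c * (ln s - ln c)) \<le> real (D choose c)"
proof -
  have "exp (c * (ln s - ln c)) = (s / c) ^ c"
    using s \<open>0 < c\<close> by (simp add: exp_of_nat_mult exp_diff)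
  also have "\<dots> \<le> (real D / c) ^ c"
    using s D by (intro power_mono divide_right_mono) auto
  also have "\<dots> \<le> real (D choose c)" using binomial_ge_n_over_k_pow_k[OF \<open>c \<le> D\<close>] by simp
  finally show ?thesis .
qed

text \<open>Here \<open>s\<close> is the expected number of points in a cell and \<open>\<beta> * s\<close> bounds the degrees
  around a site. All errors are collected in multiples of \<open>\<beta> * c\<^sup>2\<close>.\<close>

context
  fixes s \<beta> :: real and c L D2 :: nat
  assumes c: "2 \<le> c" and \<beta>: "1 \<le> \<beta>" and s: "4 \<le> s"
    and L: "L = nat \<lceil>s / 2\<rceil>" and D2: "D2 = nat \<lfloor>\<beta> * s\<rfloor>" and cL: "4 * (c + 1) \<le> L - 1"
begin

lemma isolation_bound_ge_exp:
  "exp (- (c * (c + 1) * (1 + ln \<beta> + ln s - ln c)) - 32 * \<beta> * real c ^ 2) \<le> isolation_bound c (L - 1) D2"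
proof -
  have D1: "s / 4 \<le> real (L - 1)"
  proof -
    have "s / 2 \<le> L" unfolding L by linarith
    then show ?thesis using s cL by (simp add: of_nat_diff)
  qed
  have D2le: "real D2 \<le> \<beta> * s" unfolding D2 using \<beta> s by simp
  have "L - 1 \<le> D2"
  proof -
    have "s \<le> \<beta> * s" using \<beta> s by simp
    moreover have "real L < s / 2 + 1" unfolding L using s by linarith
    ultimately have "real L \<le> \<beta> * s" using s by linarith
    then show ?thesis unfolding D2 by linarith
  qed
  then have pos: "0 < D2 choose c" using cL by simp
  have "4 * c * (c + 1) * D2 / real (L - 1) \<le> 4 * c * (c + 1) * (4 * \<beta>)"
  proof -
    have "real D2 / real (L - 1) \<le> (\<beta> * s) / (s / 4)"
      using D1 D2le s \<beta> by (intro frac_le) auto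
    then have "real D2 / real (L - 1) \<le> 4 * \<beta>" using s by simp
    then have "4 * c * (c + 1) * (real D2 / real (L - 1)) \<le> 4 * c * (c + 1) * (4 * \<beta>)"
      by (intro mult_left_mono) auto
    then show ?thesis by simp
  qed
  also have "\<dots> \<le> 32 * \<beta> * real c ^ 2"
  proof -
    have "real c * (c + 1) \<le> c * (2 * real c)" using c by (intro mult_left_mono) auto
    then have "16 * \<beta> * (real c * (c + 1)) \<le> 16 * \<beta> * (c * (2 * real c))"
      using \<beta> by (rule_tac mult_left_mono) auto
    moreover have "real (4 * c * (c + 1)) * (4 * \<beta>) = 16 * \<beta> * (real c * (c + 1))" by (simp add: algebra_simps)
    moreover have "16 * \<beta> * (c * (2 * real c)) = 32 * \<beta> * real c ^ 2" by (simp add: power2_eq_square)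
    ultimately show ?thesis by linarith
  qed
  finally have e: "4 * c * (c + 1) * D2 / real (L - 1) \<le> 32 * \<beta> * real c ^ 2" .
  have "real (D2 choose c) \<le> exp (c * (1 + ln (\<beta> * s) - ln c))"
    using c s \<beta> D2le by (intro binomial_le_exp) auto
  then have "1 / exp (c * (1 + ln (\<beta> * s) - ln c)) \<le> 1 / real (D2 choose c)"
    using pos by (intro divide_left_mono) auto
  then have "exp (- (c * (1 + ln (\<beta> * s) - ln c))) \<le> 1 / real (D2 choose c)"
    by (simp only: exp_minus inverse_eq_divide)
  then have "exp (- (c * (1 + ln (\<beta> * s) - ln c))) ^ (c + 1) \<le> (1 / real (D2 choose c)) ^ (c + 1)"
    by (intro power_mono) auto
  moreover have "exp (- (c * (1 + ln (\<beta> * s) - ln c))) ^ (c + 1)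
      = exp (- (c * (c + 1) * (1 + ln \<beta> + ln s - ln c)))"
    using s \<beta> unfolding exp_of_nat_mult[symmetric] by (simp add: ln_mult algebra_simps)
  ultimately have "exp (- (c * (c + 1) * (1 + ln \<beta> + ln s - ln c))) * exp (- 32 * \<beta> * real c ^ 2)
    \<le> isolation_bound c (L - 1) D2"
    unfolding isolation_bound_def using e by (intro mult_mono) (auto simp: algebra_simps)
  then show ?thesis by (simp add: exp_add[symmetric] exp_diff exp_minus divide_inverse)
qed

text \<open>The expected number of isolated cliques at a site. There are about \<open>(s / c) ^ (c + 1)\<close> cliques,
  and each is isolated with probability about \<open>(c / s) ^ (c * (c + 1))\<close>; the exponents add up to
  \<open>1 - c\<^sup>2\<close> in \<open>s\<close>, and in \<open>c\<close> to \<open>c\<^sup>2\<close> up to terms absorbed by the error.\<close>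

lemma expected_cliques_ge:
  "exp (ln s - real c ^ 2 * (ln s - ln c) - 40 * \<beta> * real c ^ 2)
    \<le> real (L choose (c + 1)) * isolation_bound c (L - 1) D2"
proof -
  have "s / 2 \<le> L" unfolding L by linarith
  then have "exp ((c + 1) * (ln (s / 2) - ln (c + 1))) \<le> real (L choose (c + 1))"
    using s cL by (intro binomial_ge_exp) auto
  then have "exp ((c + 1) * (ln (s / 2) - ln (c + 1))) *
      exp (- (c * (c + 1) * (1 + ln \<beta> + ln s - ln c)) - 32 * \<beta> * real c ^ 2)
      \<le> real (L choose (c + 1)) * isolation_bound c (L - 1) D2"
    using isolation_bound_ge_exp by (intro mult_mono) auto
  moreover have "ln s - real c ^ 2 * (ln s - ln c) - 40 * \<beta> * real c ^ 2
    \<le> (c + 1) * (ln (s / 2) - ln (c + 1)) - (c * (c + 1) * (1 + ln \<beta> + ln s - ln c)) - 32 * \<beta> * real c ^ 2"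
  proof -
    let ?c = "real c"
    have c2: "2 \<le> ?c" using c by simp
    have a: "(?c + 1) * ln (?c + 1) \<le> 2 * ?c ^ 2"
    proof -
      have "ln (?c + 1) \<le> ?c" using ln_add_one_self_le_self[of ?c] by (simp add: add.commute)
      then have "(?c + 1) * ln (?c + 1) \<le> (2 * ?c) * ?c"
        using c2 by (intro mult_mono) auto
      then show ?thesis by (simp add: power2_eq_square)
    qed
    have b: "(?c + 1) * ln 2 \<le> 2 * ?c ^ 2"
    proof -
      have "ln (2::real) \<le> 1" using ln_le_minus_one[of 2] by simp
      then have "(?c + 1) * ln 2 \<le> (2 * ?c) * ?c" using c2 by (intro mult_mono) auto
      then show ?thesis by (simp add: power2_eq_square)
    qed
    have d: "?c * (?c + 1) * (1 + ln \<beta>) \<le> 2 * \<beta> * ?c ^ 2"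
    proof -
      have "1 + ln \<beta> \<le> \<beta>" using ln_le_minus_one[of \<beta>] \<beta> by simp
      then have "?c * (?c + 1) * (1 + ln \<beta>) \<le> (?c * (2 * ?c)) * \<beta>"
        using c2 \<beta> by (intro mult_mono) auto
      then show ?thesis by (simp add: power2_eq_square algebra_simps)
    qed
    have l: "0 \<le> ?c * ln ?c" using c2 by simp
    have f: "4 * ?c ^ 2 \<le> 6 * \<beta> * ?c ^ 2" using \<beta> by (intro mult_right_mono) auto
    have "(c + 1) * (ln (s / 2) - ln (c + 1)) - (c * (c + 1) * (1 + ln \<beta> + ln s - ln c)) - 32 * \<beta> * ?c ^ 2
      = ln s - ?c ^ 2 * (ln s - ln ?c) + ?c * ln ?c - (?c + 1) * ln (?c + 1) - (?c + 1) * ln 2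
        - ?c * (?c + 1) * (1 + ln \<beta>) - 32 * \<beta> * ?c ^ 2"
      using s by (simp add: ln_div power2_eq_square algebra_simps)
    then show ?thesis using a b d l f by linarith
  qed
  then have "exp (ln s - real c ^ 2 * (ln s - ln c) - 40 * \<beta> * real c ^ 2)
    \<le> exp ((c + 1) * (ln (s / 2) - ln (c + 1))) *
      exp (- (c * (c + 1) * (1 + ln \<beta> + ln s - ln c)) - 32 * \<beta> * real c ^ 2)"
    unfolding exp_add[symmetric] by simp
  ultimately show ?thesis by linarith
qed

text \<open>The lower and upper bounds for the isolation probability differ by \<open>exp (O (c\<^sup>2))\<close> only, since the
  least and the largest degree are of the same order.\<close>

lemma isolation_ratio_le:
  "(1 / real ((L - 1) choose c)) ^ (c + 1) / isolation_bound c (L - 1) D2 \<le> exp (40 * \<beta> * real c ^ 2)"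
proof -
  let ?c = "real c"
  have D1: "s / 4 \<le> real (L - 1)"
  proof -
    have "s / 2 \<le> L" unfolding L by linarith
    then show ?thesis using s cL by (simp add: of_nat_diff)
  qed
  have pos: "0 < (L - 1) choose c" using cL by simp
  have "exp (c * (ln (s / 4) - ln c)) \<le> real ((L - 1) choose c)"
    using c s D1 cL by (intro binomial_ge_exp) auto
  then have "1 / real ((L - 1) choose c) \<le> 1 / exp (c * (ln (s / 4) - ln c))"
    using pos by (intro divide_left_mono) auto
  then have "1 / real ((L - 1) choose c) \<le> exp (- (c * (ln (s / 4) - ln c)))"
    by (simp only: exp_minus inverse_eq_divide)
  then have "(1 / real ((L - 1) choose c)) ^ (c + 1) \<le> exp (- (c * (ln (s / 4) - ln c))) ^ (c + 1)"
    by (intro power_mono) auto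
  also have "\<dots> = exp (- (c * (c + 1) * (ln s - ln 4 - ln c)))"
    using s unfolding exp_of_nat_mult[symmetric] by (simp add: ln_div algebra_simps)
  finally have "(1 / real ((L - 1) choose c)) ^ (c + 1) / isolation_bound c (L - 1) D2
    \<le> exp (- (c * (c + 1) * (ln s - ln 4 - ln c))) /
       exp (- (c * (c + 1) * (1 + ln \<beta> + ln s - ln c)) - 32 * \<beta> * ?c ^ 2)"
    using isolation_bound_ge_exp by (intro frac_le) auto
  also have "\<dots> = exp (?c * (?c + 1) * (1 + ln (4 * \<beta>)) + 32 * \<beta> * ?c ^ 2)"
    using \<beta> unfolding exp_diff[symmetric] by (simp add: ln_mult algebra_simps)
  also have "\<dots> \<le> exp (40 * \<beta> * ?c ^ 2)"
  proof -
    have "1 + ln (4 * \<beta>) \<le> 4 * \<beta>" using ln_le_minus_one[of "4 * \<beta>"] \<beta> by simp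
    then have "?c * (?c + 1) * (1 + ln (4 * \<beta>)) \<le> (?c * (2 * ?c)) * (4 * \<beta>)"
      using c \<beta> by (intro mult_mono) auto
    then show ?thesis by (simp add: power2_eq_square algebra_simps)
  qed
  finally show ?thesis .
qed

end

section \<open>The threshold\<close>

text \<open>This is where the constant \<open>lam / (lam - 1 / 2)\<close> comes from. As \<open>c\<^sup>2\<close> is about
  \<open>(1 - \<epsilon>) * \<theta> * ln n / ln N\<close> with \<open>ln N \<approx> lam * ln (ln n)\<close>, we have
  \<open>ln c \<approx> ln (ln n) / 2 \<approx> ln N / (2 * lam)\<close>, so that \<open>ln N - ln c \<approx> ln N / \<theta>\<close> for
  \<open>\<theta> = lam / (lam - 1 / 2)\<close>, and \<open>c\<^sup>2 * (ln N - ln c)\<close> is about \<open>(1 - \<epsilon>) * ln n\<close>. For infinite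
  \<open>lam\<close>, the term \<open>ln c\<close> is negligible and can be dropped.\<close>

lemma clique_exponent_bounds:
  fixes N :: "nat \<Rightarrow> real" and c :: "nat \<Rightarrow> nat" and \<epsilon> :: real and lam :: ereal
  assumes \<epsilon>: "0 < \<epsilon>" "\<epsilon> < 1" and lam: "1 \<le> lam"
    and N: "filterlim N at_top sequentially"
    and lim: "(\<lambda>n. ereal (ln (N n) / ln (ln n))) \<longlonglongrightarrow> lam"
    and c: "\<And>n. c n = nat \<lfloor>sqrt ((1 - \<epsilon>) *
           (if lam = \<infinity> then 1 else real_of_ereal lam / (real_of_ereal lam - 1 / 2)) *
           (ln n / ln (N n)))\<rfloor>"
    and c2: "\<forall>\<^sub>F n in sequentially. 2 \<le> c n"
  shows "\<forall>\<^sub>F n in sequentially. real (c n) ^ 2 * ln (N n) \<le> 2 * ln n"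
    and "\<forall>\<^sub>F n in sequentially. real (c n) ^ 2 * (ln (N n) - ln (c n)) \<le> (1 - \<epsilon> / 2) * ln n"
proof -
  define \<theta> where "\<theta> = (if lam = \<infinity> then 1 else real_of_ereal lam / (real_of_ereal lam - 1 / 2))"
  define y where "y = (\<lambda>n. (1 - \<epsilon>) * \<theta> * (ln n / ln (N n)))"
  have cy: "c n = nat \<lfloor>sqrt (y n)\<rfloor>" for n by (simp add: c y_def \<theta>_def)
  have \<theta>: "1 \<le> \<theta>" "\<theta> \<le> 2"
  proof -
    have "1 \<le> \<theta> \<and> \<theta> \<le> 2"
    proof (cases lam)
      case (real l)
      then have "1 \<le> l" using lam by (simp add: one_ereal_def)
      then show ?thesis using real by (simp add: \<theta>_def field_simps)
    qed (use lam in \<open>auto simp: \<theta>_def\<close>)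
    then show "1 \<le> \<theta>" "\<theta> \<le> 2" by auto
  qed
  have lnN: "filterlim (\<lambda>n. ln (N n)) at_top sequentially"
    using N by (rule filterlim_compose[OF ln_at_top])
  have lnn: "filterlim (\<lambda>n. ln (real n)) at_top sequentially"
    by (rule filterlim_compose[OF ln_at_top filterlim_real_sequentially])
  have lnN1: "\<forall>\<^sub>F n in sequentially. 1 \<le> ln (N n)" and lnn1: "\<forall>\<^sub>F n in sequentially. 1 < ln (real n)"
    using lnN lnn by (simp_all only: filterlim_at_top[of "\<lambda>n. ln (N n)"] filterlim_at_top_dense[of "\<lambda>n. ln (real n)"])
  have main: "\<forall>\<^sub>F n in sequentially. real (c n) ^ 2 * ln (N n) \<le> (1 - \<epsilon>) * \<theta> * ln n"
    using c2 lnN1 lnn1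
  proof eventually_elim
    case (elim n)
    have y0: "0 \<le> y n" unfolding y_def using elim \<epsilon> \<theta> by simp
    have "real (c n) \<le> sqrt (y n)" unfolding cy using y0 by simp
    then have "real (c n) ^ 2 \<le> y n"
      using y0 by (metis of_nat_0_le_iff power_mono real_sqrt_pow2)
    then have "real (c n) ^ 2 * ln (N n) \<le> y n * ln (N n)"
      using elim by (intro mult_right_mono) auto
    also have "\<dots> = (1 - \<epsilon>) * \<theta> * ln n" unfolding y_def using elim by simp
    finally show ?case .
  qed
  show "\<forall>\<^sub>F n in sequentially. real (c n) ^ 2 * ln (N n) \<le> 2 * ln n"
    using main lnn1
  proof eventually_elim
    case (elim n)
    have "(1 - \<epsilon>) * \<theta> \<le> 1 * 2" using \<epsilon> \<theta> by (intro mult_mono) auto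
    then have "(1 - \<epsilon>) * \<theta> * ln n \<le> 1 * 2 * ln n" using elim by (intro mult_right_mono) auto
    then show ?case using elim by linarith
  qed
  show "\<forall>\<^sub>F n in sequentially. real (c n) ^ 2 * (ln (N n) - ln (c n)) \<le> (1 - \<epsilon> / 2) * ln n"
  proof (cases lam)
    case MInf
    then show ?thesis using lam by simp
  next
    case PInf
    then have "\<theta> = 1" by (simp add: \<theta>_def)
    show ?thesis using main c2 lnn1
    proof eventually_elim
      case (elim n)
      have "real (c n) ^ 2 * (ln (N n) - ln (c n)) \<le> real (c n) ^ 2 * ln (N n)"
        using elim by (intro mult_left_mono) auto
      also have "\<dots> \<le> (1 - \<epsilon>) * ln n" using elim \<open>\<theta> = 1\<close> by simp
      also have "\<dots> \<le> (1 - \<epsilon> / 2) * ln n" using elim \<epsilon> by (intro mult_right_mono) auto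
      finally show ?case .
    qed
  next
    case (real l)
    then have l: "1 \<le> l" using lam by (simp add: one_ereal_def)
    have \<theta>l: "\<theta> = l / (l - 1 / 2)" using real by (simp add: \<theta>_def)
    have \<theta>inv: "\<theta> * (1 - 1 / (2 * l)) = 1" unfolding \<theta>l using l by (simp add: field_simps)
    have "(\<lambda>n. ln (N n) / ln (ln n)) \<longlonglongrightarrow> l" using lim real by simp
    then have "(\<lambda>n. inverse (ln (N n) / ln (ln n))) \<longlonglongrightarrow> inverse l"
      using l by (intro tendsto_inverse) auto
    then have w: "(\<lambda>n. ln (ln n) / ln (N n)) \<longlonglongrightarrow> 1 / l" by (simp add: inverse_eq_divide)
    have lln: "(\<lambda>n. ln (ln (N n)) / ln (N n)) \<longlonglongrightarrow> 0"
      by (rule filterlim_compose[OF ln_x_over_x_tendsto_0 lnN])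
    have const: "(\<lambda>n. ln ((1 - \<epsilon>) * \<theta> / 4) / ln (N n)) \<longlonglongrightarrow> 0"
      by (rule real_tendsto_divide_at_top[OF tendsto_const lnN])
    let ?v = "\<lambda>n. 1 / 2 * (ln (ln n) / ln (N n) - ln (ln (N n)) / ln (N n) + ln ((1 - \<epsilon>) * \<theta> / 4) / ln (N n))"
    have "?v \<longlonglongrightarrow> 1 / 2 * (1 / l - 0 + 0)"
      by (intro tendsto_intros w lln const)
    then have v: "\<forall>\<^sub>F n in sequentially. 1 / (2 * l) - \<epsilon> / 8 < ?v n"
      using order_tendstoD(1)[of ?v "1 / 2 * (1 / l - 0 + 0)" sequentially "1 / (2 * l) - \<epsilon> / 8"] \<epsilon> by simp
    show ?thesis using main c2 lnn1 lnN1 v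
    proof eventually_elim
      case (elim n)
      have y0: "0 < y n" unfolding y_def using elim \<epsilon> \<theta> by simp
      have "sqrt (y n) - 1 < c n" unfolding cy by linarith
      moreover have "2 \<le> sqrt (y n)" using elim(2) unfolding cy by linarith
      ultimately have "sqrt (y n) / 2 \<le> c n" by linarith
      then have "(sqrt (y n) / 2) ^ 2 \<le> real (c n) ^ 2" using y0 by (intro power_mono) auto
      then have "y n / 4 \<le> real (c n) ^ 2" using y0 by (simp add: power_divide)
      then have ln_le: "ln (y n / 4) \<le> ln (real (c n) ^ 2)"
        using y0 elim(2) by (subst ln_le_cancel_iff) auto
      have "y n / 4 = ((1 - \<epsilon>) * \<theta> / 4) * (ln n / ln (N n))" unfolding y_def by simp
      then have "ln ((1 - \<epsilon>) * \<theta> / 4) + (ln (ln n) - ln (ln (N n))) = ln (y n / 4)"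
        using \<epsilon> \<theta> elim by (simp only:) (subst ln_mult_pos, auto simp: ln_div)
      also note ln_le
      also have "ln (real (c n) ^ 2) = 2 * ln (c n)" using elim(2) by (simp add: ln_realpow)
      finally have half: "1 / 2 * (ln ((1 - \<epsilon>) * \<theta> / 4) + (ln (ln n) - ln (ln (N n)))) \<le> ln (c n)"
        by simp
      have "?v n * ln (N n) = 1 / 2 * (ln ((1 - \<epsilon>) * \<theta> / 4) + (ln (ln n) - ln (ln (N n))))"
        using elim by (simp add: field_simps)
      then have "?v n * ln (N n) \<le> ln (c n)" using half by (simp only:)
      moreover have "(1 / (2 * l) - \<epsilon> / 8) * ln (N n) \<le> ?v n * ln (N n)"
        using elim by (intro mult_right_mono) auto
      ultimately have lnc: "ln (N n) - ln (c n) \<le> ln (N n) * ((1 - 1 / (2 * l)) + \<epsilon> / 8)"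
        by (simp add: algebra_simps)
      have "real (c n) ^ 2 * (ln (N n) - ln (c n)) \<le> real (c n) ^ 2 * (ln (N n) * ((1 - 1 / (2 * l)) + \<epsilon> / 8))"
        using lnc by (intro mult_left_mono) auto
      also have "\<dots> = real (c n) ^ 2 * ln (N n) * ((1 - 1 / (2 * l)) + \<epsilon> / 8)" by simp
      also have "\<dots> \<le> (1 - \<epsilon>) * \<theta> * ln n * ((1 - 1 / (2 * l)) + \<epsilon> / 8)"
      proof (rule mult_right_mono)
        have "1 / (2 * l) \<le> 1" using l by simp
        then show "0 \<le> (1 - 1 / (2 * l)) + \<epsilon> / 8" using \<epsilon> by linarith
      qed (rule elim(1))
      also have "\<dots> = (1 - \<epsilon>) * ln n * (\<theta> * (1 - 1 / (2 * l)) + \<theta> * \<epsilon> / 8)"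
      proof -
        have "(1 - \<epsilon>) * \<theta> * x * (a + \<epsilon> / 8) = (1 - \<epsilon>) * x * (\<theta> * a + \<theta> * \<epsilon> / 8)" for x a :: real
          by (simp add: field_simps)
        then show ?thesis .
      qed
      also have "\<dots> = (1 - \<epsilon>) * (1 + \<theta> * \<epsilon> / 8) * ln n" unfolding \<theta>inv by simp
      also have "\<dots> \<le> (1 - \<epsilon> / 2) * ln n"
      proof (rule mult_right_mono)
        have "\<theta> * \<epsilon> / 8 \<le> \<epsilon> / 4" using \<epsilon> \<theta> by simp
        then have "(1 - \<epsilon>) * (1 + \<theta> * \<epsilon> / 8) \<le> (1 - \<epsilon>) * (1 + \<epsilon> / 4)"
          using \<epsilon> by (intro mult_left_mono) auto
        also have "\<dots> \<le> 1 - \<epsilon> / 2" using \<epsilon> by (simp add: algebra_simps)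
        finally show "(1 - \<epsilon>) * (1 + \<theta> * \<epsilon> / 8) \<le> 1 - \<epsilon> / 2" .
      qed (use elim in auto)
      finally show ?case .
    qed
  qed
qed

theorem theorem2:
  fixes r :: "nat \<Rightarrow> real" and c :: "nat \<Rightarrow> nat" and \<epsilon> :: real and lam :: ereal
  assumes "0 < \<epsilon>" and "\<epsilon> < 1"
    and "1 \<le> lam"
    and "\<forall>\<^sub>F n in sequentially.
           3 * 2 powr (1 / CARD('d::finite)) * (ln n / n) powr (1 / CARD('d)) < r n \<and> r n < 1"
    and "(\<lambda>n. ereal (ln (n * r n ^ CARD('d)) / ln (ln n))) \<longlonglongrightarrow> lam"
    and "\<And>n. c n = nat \<lfloor>sqrt ((1 - \<epsilon>) *
           (if lam = \<infinity> then 1 else real_of_ereal lam / (real_of_ereal lam - 1 / 2)) *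
           (ln n / ln (n * r n ^ CARD('d))))\<rfloor>"
    and "\<forall>\<^sub>F n in sequentially. 2 \<le> c n \<and> c n < n"
  shows "(\<lambda>n. measure (irrigation_graph TYPE('d) n (r n) (c n))
           {E. \<not> connected_graph {1..n} E}) \<longlonglongrightarrow> 1"
proof -
  let ?d = "CARD('d)"
  define N where "N = (\<lambda>n. real n * r n ^ ?d)"
  define \<alpha> where "\<alpha> = (1 / real ?d) ^ ?d"
  define \<beta> where "\<beta> = 2 * (4 * real ?d + 1) ^ ?d"
  define \<gamma> where "\<gamma> = \<alpha> / (2 * 10 ^ ?d)"
  define s where "s = (\<lambda>n. real n * (r n / ?d) ^ ?d)"
  define P where "P = (\<lambda>n. measure (irrigation_graph TYPE('d) n (r n) (c n)) {E. \<not> connected_graph {1..n} E})"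
  have d: "1 \<le> real ?d" by (simp add: Suc_le_eq)
  have \<alpha>: "0 < \<alpha>" "\<alpha> \<le> 1" unfolding \<alpha>_def using d by (auto intro!: power_le_one)
  have \<beta>: "1 \<le> \<beta>"
  proof -
    have "1 \<le> (4 * real ?d + 1) ^ ?d" by (intro one_le_power) simp
    then show ?thesis unfolding \<beta>_def by linarith
  qed
  have \<gamma>: "0 < \<gamma>" unfolding \<gamma>_def using \<alpha> by simp
  have s_N: "s n = \<alpha> * N n" for n unfolding s_def N_def \<alpha>_def by (simp add: power_divide)
  have n3: "\<forall>\<^sub>F n in sequentially. 3 \<le> (n :: nat)" by (rule eventually_ge_at_top)
  have N_ge: "\<forall>\<^sub>F n in sequentially. 0 < r n \<and> ln (real n) \<le> N n"
    using assms(4) n3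
  proof eventually_elim
    case (elim n)
    let ?q = "(ln n / n) powr (1 / ?d)"
    have lnpos: "0 < ln (real n)" using elim by simp
    then have pos: "0 < ln (real n) / n" using elim by simp
    have q: "?q ^ ?d = ln n / n"
    proof -
      have "?q ^ ?d = ?q powr real ?d" using pos elim by (subst powr_realpow) auto
      also have "\<dots> = ln n / n" using pos lnpos d by (simp add: powr_powr)
      finally show ?thesis .
    qed
    have "1 \<le> 2 powr (1 / real ?d)" by (intro ge_one_powr_ge_zero) auto
    then have "1 * ?q \<le> 3 * 2 powr (1 / ?d) * ?q" by (intro mult_right_mono) auto
    then have qr: "?q < r n" using elim by linarith
    have "?q ^ ?d \<le> r n ^ ?d" using qr by (intro power_mono) auto
    then have "ln n \<le> N n" using elim unfolding q N_def by (simp add: field_simps)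
    moreover have "0 < ?q" using lnpos elim by simp
    ultimately show ?case using qr by linarith
  qed
  have lnn: "filterlim (\<lambda>n. ln (real n)) at_top sequentially"
    by (rule filterlim_compose[OF ln_at_top filterlim_real_sequentially])
  have N: "filterlim N at_top sequentially"
    by (rule filterlim_at_top_mono[OF lnn]) (use N_ge in eventually_elim, simp)
  have lnN: "filterlim (\<lambda>n. ln (N n)) at_top sequentially"
    using N by (rule filterlim_compose[OF ln_at_top])
  have c2: "\<forall>\<^sub>F n in sequentially. 2 \<le> c n" using assms(7) by eventually_elim simp
  have lim_N: "(\<lambda>n. ereal (ln (N n) / ln (ln n))) \<longlonglongrightarrow> lam"
    unfolding N_def by (rule assms(5))
  have c_N: "c n = nat \<lfloor>sqrt ((1 - \<epsilon>) *
      (if lam = \<infinity> then 1 else real_of_ereal lam / (real_of_ereal lam - 1 / 2)) * (ln n / ln (N n)))\<rfloor>" for n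
    unfolding N_def by (rule assms(6))
  note exponent_bounds = clique_exponent_bounds[OF assms(1-3) N lim_N c_N c2]
  have big_lnN: "\<forall>\<^sub>F n in sequentially. K \<le> ln (N n)" for K
    using lnN unfolding filterlim_at_top by blast
  have big_N: "\<forall>\<^sub>F n in sequentially. K \<le> N n" for K
    using N unfolding filterlim_at_top by blast
  have big_lnn: "\<forall>\<^sub>F n in sequentially. K \<le> ln (real n)" for K
    using lnn unfolding filterlim_at_top by blast
  \<comment> \<open>The bounds on \<open>ln (N n)\<close> turn \<open>c\<^sup>2 * ln N \<le> 2 * ln n\<close> into \<open>80 * \<beta> * c\<^sup>2 \<le> \<epsilon> / 4 * ln n\<close> and
    \<open>32 * c\<^sup>2 \<le> s\<close>; the bound on \<open>ln n\<close>, together with \<open>N \<le> sqrt n\<close>, gives \<open>5 * r \<le> 1\<close>.\<close>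
  have lower: "\<forall>\<^sub>F n in sequentially. 1 - (4 * real ?d + 1) ^ ?d * (8 / s n)
      - 2 / \<gamma> * exp (- (\<epsilon> / 4) * ln n) \<le> P n"
    using N_ge n3 c2 exponent_bounds big_lnN[of 1] big_lnN[of "640 * \<beta> / \<epsilon>"] big_lnN[of "64 / \<alpha>"]
      big_N[of "4 / \<alpha>"] big_lnn[of "2 * ?d * ln 5"]
  proof eventually_elim
    case (elim n)
    let ?c = "real (c n)"
    let ?L = "nat \<lceil>s n / 2\<rceil>"
    let ?D2 = "nat \<lfloor>\<beta> * s n\<rfloor>"
    let ?m = "nat \<lfloor>1 / (5 * r n)\<rfloor>"
    let ?k = "real (?m ^ ?d) / 2"
    let ?p = "isolation_bound (c n) (?L - 1) ?D2"
    have r: "0 < r n" and lnnN: "ln n \<le> N n" using elim by auto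
    have c: "2 \<le> ?c" using elim by simp
    have n: "0 < real n" "0 < ln (real n)" using elim by auto
    have Npos: "0 < N n" using lnnN n by linarith
    have s: "0 < s n" "4 \<le> s n" "ln (s n) \<le> ln (N n)"
    proof -
      show "0 < s n" using \<alpha> Npos by (simp add: s_N)
      show "4 \<le> s n" using elim(9) \<alpha> by (simp add: s_N field_simps)
      show "ln (s n) \<le> ln (N n)" using \<alpha> Npos unfolding s_N by (subst ln_le_cancel_iff) auto
    qed
    have c4: "4 \<le> ?c ^ 2" using power_mono[OF c, of 2] by simp
    \<comment> \<open>As \<open>c \<ge> 2\<close>, this makes the number of blocks at least of the order \<open>sqrt n\<close>.\<close>
    have half: "ln (N n) \<le> ln n / 2"
    proof -
      have "4 * ln (N n) \<le> ?c ^ 2 * ln (N n)" using c4 elim(6) by (intro mult_right_mono) auto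
      then show ?thesis using elim(4) by linarith
    qed
    have c_small: "K * ?c ^ 2 \<le> 2 * ln n" if "K \<le> ln (N n)" for K
    proof -
      have "K * ?c ^ 2 \<le> ln (N n) * ?c ^ 2" using that by (intro mult_right_mono) auto
      then show ?thesis using elim(4) by (simp add: mult.commute)
    qed
    \<comment> \<open>The number of cliques and the correlation are estimated up to a factor \<open>exp (40 * \<beta> * c\<^sup>2)\<close>,
      whose square is at most \<open>n powr (\<epsilon> / 4)\<close>.\<close>
    have err: "80 * \<beta> * ?c ^ 2 \<le> \<epsilon> / 4 * ln n"
    proof -
      have "640 * \<beta> / \<epsilon> * ?c ^ 2 \<le> 2 * ln n" by (rule c_small[OF elim(7)])
      then have "640 * \<beta> * ?c ^ 2 \<le> 2 * ln n * \<epsilon>" using assms(1) by (simp add: field_simps)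
      then show ?thesis by simp
    qed
    have cs: "16 * ?c + 16 \<le> s n / 2"
    proof -
      have "64 / \<alpha> * ?c ^ 2 \<le> 2 * ln n" by (rule c_small[OF elim(8)])
      then have "64 * ?c ^ 2 \<le> 2 * ln n * \<alpha>" using \<alpha> by (simp add: field_simps)
      also have "\<dots> \<le> 2 * N n * \<alpha>" using lnnN \<alpha> by (intro mult_right_mono) auto
      finally have "32 * ?c ^ 2 \<le> s n" by (simp add: s_N mult.commute)
      moreover have "?c + 1 \<le> ?c ^ 2"
      proof -
        have "2 * ?c \<le> ?c ^ 2" using c by (simp add: power2_eq_square)
        then show ?thesis using c by linarith
      qed
      ultimately show ?thesis by argo
    qed
    have cL: "4 * (c n + 1) \<le> ?L - 1"
    proof -
      have "real (4 * (c n + 1)) + 1 \<le> s n / 2" using cs c by simp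
      then show ?thesis by linarith
    qed
    have cn: "c n + 1 < n"
    proof -
      have "N n < n"
      proof -
        have "ln (N n) < ln n" using half n by linarith
        then show ?thesis using Npos n by simp
      qed
      moreover have "s n \<le> N n" using \<alpha> Npos by (simp add: s_N)
      ultimately show ?thesis using cs c by linarith
    qed
    have r5: "5 * r n \<le> 1"
    proof -
      have "ln (N n) = ln n + ?d * ln (r n)"
        unfolding N_def using n r by (simp add: ln_mult ln_realpow)
      then have "?d * ln (r n) \<le> ?d * (- ln 5)" using half elim(10) by simp
      then have "ln (r n) \<le> - ln 5" using d by (subst (asm) mult_le_cancel_left_pos) auto
      then have "ln (5 * r n) \<le> ln 1" using r by (simp add: ln_mult)
      then show ?thesis using r by (subst (asm) ln_le_cancel_iff) auto
    qed
    have m: "1 / (10 * r n) \<le> ?m" "5 * ?m * r n \<le> 1" "0 < ?m"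
    proof -
      have 1: "1 \<le> 1 / (5 * r n)" using r5 r by simp
      have "t < 2 * real (nat \<lfloor>t\<rfloor>)" if "1 \<le> t" for t :: real
      proof -
        have "1 \<le> \<lfloor>t\<rfloor>" using that by simp
        then show ?thesis by linarith
      qed
      from this[OF 1] have "1 / (5 * r n) < 2 * real ?m" .
      then show "1 / (10 * r n) \<le> ?m" by simp
      have "real ?m \<le> 1 / (5 * r n)" using 1 by linarith
      then have "real ?m * (5 * r n) \<le> 1 / (5 * r n) * (5 * r n)" using r by (intro mult_right_mono) auto
      also have "\<dots> = 1" using r by simp
      finally show "5 * ?m * r n \<le> 1" by (simp only: of_nat_mult of_nat_numeral mult_ac)
      show "0 < ?m" using 1 by linarith
    qed
    \<comment> \<open>Half of the blocks are good; \<open>\<gamma>\<close> collects the constants in the number of blocks.\<close>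
    have k: "\<gamma> * (n / s n) \<le> ?k"
    proof -
      have "n / s n = 1 / (\<alpha> * r n ^ ?d)" using n by (simp add: s_N N_def)
      then have "\<gamma> * (n / s n) = (1 / (10 * r n)) ^ ?d / 2"
        unfolding \<gamma>_def using \<alpha> by (simp add: power_divide power_mult_distrib field_simps)
      also have "\<dots> \<le> real ?m ^ ?d / 2"
        using m(1) r by (intro divide_right_mono power_mono) auto
      finally show ?thesis by simp
    qed
    have ns: "n / s n = exp (ln n - ln (s n))" using n s by (simp add: exp_diff)
    have k0: "0 < ?k" using m by simp
    note est = elim(3) \<beta> s(2) refl refl cL
    have first: "1 / (?k * real (?L choose (c n + 1)) * ?p) \<le> 1 / \<gamma> * exp (- (\<epsilon> / 4) * ln n)"
    proof -
      have "\<gamma> * exp (\<epsilon> / 4 * ln n) \<le>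
          \<gamma> * (exp (ln n - ln (s n)) * exp (ln (s n) - ?c ^ 2 * (ln (s n) - ln ?c) - 40 * \<beta> * ?c ^ 2))"
      proof -
        have "?c ^ 2 * (ln (s n) - ln ?c) \<le> ?c ^ 2 * (ln (N n) - ln ?c)"
          using s(3) by (intro mult_left_mono) auto
        moreover have "?c ^ 2 * (ln (N n) - ln ?c) \<le> ln n - 2 * (\<epsilon> / 4 * ln n)"
          using elim(5) by (simp add: algebra_simps)
        moreover have "2 * (40 * \<beta> * ?c ^ 2) \<le> \<epsilon> / 4 * ln n" using err by simp
        moreover have "0 \<le> 40 * \<beta> * ?c ^ 2" using \<beta> by simp
        ultimately have "\<epsilon> / 4 * ln n \<le> ln n - ?c ^ 2 * (ln (s n) - ln ?c) - 40 * \<beta> * ?c ^ 2"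
          by argo
        then show ?thesis unfolding exp_add[symmetric] using \<gamma> by (intro mult_left_mono) auto
      qed
      also have "\<dots> = \<gamma> * (n / s n) * exp (ln (s n) - ?c ^ 2 * (ln (s n) - ln ?c) - 40 * \<beta> * ?c ^ 2)"
        by (simp only: ns mult.assoc)
      also have "\<dots> \<le> ?k * (real (?L choose (c n + 1)) * ?p)"
        using k expected_cliques_ge[OF est] k0 by (intro mult_mono) auto
      finally have "1 / (?k * (real (?L choose (c n + 1)) * ?p)) \<le> 1 / (\<gamma> * exp (\<epsilon> / 4 * ln n))"
        using \<gamma> by (intro frac_le) auto
      then show ?thesis by (simp add: exp_minus field_simps)
    qed
    have second: "((1 / real ((?L - 1) choose c n)) ^ (c n + 1) / ?p)\<^sup>2 / ?k \<le> 1 / \<gamma> * exp (- (\<epsilon> / 4) * ln n)"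
    proof -
      have "((1 / real ((?L - 1) choose c n)) ^ (c n + 1) / ?p)\<^sup>2 \<le> (exp (40 * \<beta> * ?c ^ 2))\<^sup>2"
        using isolation_ratio_le[OF est] by (intro power_mono) (auto simp: isolation_bound_def)
      also have "\<dots> = exp (80 * \<beta> * ?c ^ 2)" by (simp add: exp_of_nat_mult[symmetric])
      finally have "((1 / real ((?L - 1) choose c n)) ^ (c n + 1) / ?p)\<^sup>2 / ?k
          \<le> exp (80 * \<beta> * ?c ^ 2) / (\<gamma> * exp (ln n - ln (s n)))"
        using k \<gamma> unfolding ns by (intro frac_le) auto
      also have "\<dots> = 1 / \<gamma> * exp (80 * \<beta> * ?c ^ 2 - (ln n - ln (s n)))"
        by (simp add: exp_diff)
      also have "\<dots> \<le> 1 / \<gamma> * exp (- (\<epsilon> / 4) * ln n)"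
      proof -
        have "\<epsilon> * ln n \<le> 1 * ln n" using assms(2) n by (intro mult_right_mono) auto
        then have "80 * \<beta> * ?c ^ 2 - (ln n - ln (s n)) \<le> - (\<epsilon> / 4) * ln n"
          using err half s(3) by simp
        then show ?thesis using \<gamma> by (intro mult_left_mono) auto
      qed
      finally show ?thesis .
    qed
    have sn: "real n * (r n / ?d) ^ ?d = s n" by (simp add: s_def)
    have D2: "nat \<lfloor>real ((4 * ?d + 1) ^ ?d) * (2 * s n)\<rfloor> = ?D2" by (simp add: \<beta>_def ac_simps)
    have "1 - real ((4 * ?d + 1) ^ ?d) * (8 / s n) - 1 / (?k * real (?L choose (c n + 1)) * ?p)
        - ((1 / real ((?L - 1) choose c n)) ^ (c n + 1) / ?p)\<^sup>2 / ?k \<le> P n"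
      using prob_disconnected_ge[OF r m(2,3), of "c n" n, where ?'d = 'd, unfolded sn D2, OF cL cn]
      unfolding P_def .
    moreover have "real ((4 * ?d + 1) ^ ?d) = (4 * real ?d + 1) ^ ?d" by (simp add: add.commute)
    moreover have "2 / \<gamma> * exp (- (\<epsilon> / 4) * ln n) =
        1 / \<gamma> * exp (- (\<epsilon> / 4) * ln n) + 1 / \<gamma> * exp (- (\<epsilon> / 4) * ln n)" by simp
    ultimately show ?case using first second by (simp only:)
  qed
  have "filterlim s at_top sequentially"
    unfolding s_N using \<alpha> N by (intro filterlim_tendsto_pos_mult_at_top[OF tendsto_const]) auto
  then have l1: "(\<lambda>n. 8 / s n) \<longlonglongrightarrow> 0"
    by (rule real_tendsto_divide_at_top[OF tendsto_const])
  have "filterlim (\<lambda>n. - (\<epsilon> / 4) * ln (real n)) at_bot sequentially"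
    using assms(1) lnn by (intro filterlim_tendsto_neg_mult_at_bot[OF tendsto_const]) auto
  then have l2: "(\<lambda>n. exp (- (\<epsilon> / 4) * ln (real n))) \<longlonglongrightarrow> 0"
    by (rule filterlim_compose[OF exp_at_bot])
  have "(\<lambda>n. 1 - (4 * real ?d + 1) ^ ?d * (8 / s n) - 2 / \<gamma> * exp (- (\<epsilon> / 4) * ln n))
      \<longlonglongrightarrow> 1 - (4 * real ?d + 1) ^ ?d * 0 - 2 / \<gamma> * 0"
    by (intro tendsto_intros l1 l2)
  then have low: "(\<lambda>n. 1 - (4 * real ?d + 1) ^ ?d * (8 / s n) - 2 / \<gamma> * exp (- (\<epsilon> / 4) * ln n)) \<longlonglongrightarrow> 1"
    by simp
  have up: "P n \<le> 1" for n
    unfolding P_def by (rule prob_space.prob_le_1[OF prob_space_irrigation_graph])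
  have "P \<longlonglongrightarrow> 1"
    by (rule tendsto_sandwich[OF lower _ low tendsto_const]) (use up in simp)
  then show ?thesis by (simp only: P_def)
qed

end
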